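(* Assume (A3), (A4), let $q\in(0,1)$, $p\in(0,2]$ with $p<q+1$, and let $x$ be a bounded trajectory solution of (MTRIGS) with initial data $(x_0,v_0)$. Then $x(t)$ converges strongly, as $t\to+\infty$, to a weak Pareto optimal point $x^*$ of $\min_{x\in\mathcal H}F(x)$, and $x^*$ is the element of minimum norm of $\bigcap_{i=1}^m\{x\in\mathcal H: f_i(x)\le f_i(x^* )\}$.
   Context: $\mathcal H$ real Hilbert space; $f_1,\dots,f_m:\mathcal H\to\mathbb R$ convex, continuously differentiable with Lipschitz continuous gradients; $F=(f_1,\dots,f_m)^\top$. Weak Pareto optimal: no $x$ with $f_i(x)<f_i(x^* )$ for all $i$; $\mathcal P_w$ the set of such points. $\mathcal L(F,b):=\{x:f_i(x)\le b_i\ \forall i\}$, $\mathcal{LP}_w(F,b):=\mathcal L(F,b)\cap\mathcal P_w$. Parameters $t_0>0$, $\alpha,\beta>0$, $q\in(0,1]$, $p\in(0,2]$, initial data $x_0,v_0\in\mathcal H$; $C(x):=\operatorname{conv}\{\nabla f_i(x)\}$. A trajectory solution of (MTRIGS) is $x:[t_0,\infty)\to\mathcal H$, continuously differentiable, with $\dot x$ absolutely continuous on each $[t_0,T]$ and a.e. derivative $\ddot x$ (Bochner measurable, $\dot x(t)=\dot x(t_0)+\int_{t_0}^t\ddot x$), satisfying $\frac{\alpha}{t^q}\dot x(t)+\operatorname{proj}_{C(x(t))+\frac{\beta}{t^p}x(t)+\ddot x(t)}(0)=0$ for a.e. $t\ge t_0$, $x(t_0)=x_0$, $\dot x(t_0)=v_0$.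 (A3): with $a_i:=\frac{\beta}{2t_0^p}\|x_0\|^2+\frac12\|v_0\|^2$, for every $x\in\mathcal L(F,F(x_0)+a)$, $\mathcal{LP}_w(F,F(x))\ne\emptyset$, and $R:=\sup_{F^*\in F(\mathcal{LP}_w(F,F(x_0)+a))}\inf_{z\in F^{-1}(\{F^*\})}\|z\|<\infty$. (A4): $S(w):=\operatorname{argmin}_z\max_i(f_i(z)-w_i)\neq\emptyset$ for all $w\in\mathbb R^m$ and $w\mapsto\operatorname{proj}_{S(w)}(0)$ is continuous. *)

theory Defs
  imports "HOL-Analysis.Analysis"
begin

text \<open>Projection of the origin onto a set S: the element of S of minimal norm
  (well defined and unique for nonempty closed convex sets in a Hilbert space).\<close>
definition proj0 :: "'a::real_inner set \<Rightarrow> 'a" where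
  "proj0 S = (THE z. z \<in> S \<and> (\<forall>w\<in>S. norm z \<le> norm w))"

definition weak_pareto :: "('i::finite \<Rightarrow> 'a \<Rightarrow> real) \<Rightarrow> 'a \<Rightarrow> bool" where
  "weak_pareto f xs \<longleftrightarrow> \<not> (\<exists>x. \<forall>i. f i x < f i xs)"

definition sublevel :: "('i::finite \<Rightarrow> 'a \<Rightarrow> real) \<Rightarrow> ('i \<Rightarrow> real) \<Rightarrow> 'a set" where
  "sublevel f b = {x. \<forall>i. f i x \<le> b i}"

definition LPw :: "('i::finite \<Rightarrow> 'a \<Rightarrow> real) \<Rightarrow> ('i \<Rightarrow> real) \<Rightarrow> 'a set" where
  "LPw f b = sublevel f b \<inter> {x. weak_pareto f x}"

definition abs_cont_on :: "real \<Rightarrow> real \<Rightarrow> (real \<Rightarrow> 'a::real_normed_vector) \<Rightarrow> bool" where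
  "abs_cont_on a b g \<longleftrightarrow>
     (\<forall>\<epsilon>>0. \<exists>\<delta>>0. \<forall>n::nat. \<forall>l r :: nat \<Rightarrow> real.
        (\<forall>k<n. a \<le> l k \<and> l k \<le> r k \<and> r k \<le> b) \<longrightarrow>
        (\<forall>j<n. \<forall>k<n. j \<noteq> k \<longrightarrow> r j \<le> l k \<or> r k \<le> l j) \<longrightarrow>
        (\<Sum>k<n. r k - l k) < \<delta> \<longrightarrow>
        (\<Sum>k<n. norm (g (r k) - g (l k))) < \<epsilon>)"

definition Cset :: "('i::finite \<Rightarrow> 'a \<Rightarrow> 'a::real_inner) \<Rightarrow> 'a \<Rightarrow> 'a set" where
  "Cset grad x = convex hull (range (\<lambda>i. grad i x))"

definition mtrigs_solution ::
  "('i::finite \<Rightarrow> 'a \<Rightarrow> 'a::real_inner) \<Rightarrow> real \<Rightarrow> real \<Rightarrow> real \<Rightarrow> real \<Rightarrow> real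
    \<Rightarrow> 'a \<Rightarrow> 'a \<Rightarrow> (real \<Rightarrow> 'a) \<Rightarrow> bool" where
  "mtrigs_solution grad t0 \<alpha> \<beta> q p x0 v0 x \<longleftrightarrow>
     (\<exists>xd xdd.
        (\<forall>t\<ge>t0. (x has_vector_derivative xd t) (at t within {t0..})) \<and>
        continuous_on {t0..} xd \<and>
        (\<forall>T\<ge>t0. abs_cont_on t0 T xd) \<and>
        (\<exists>N. negligible N \<and> (\<forall>t\<in>{t0..} - N. (xd has_vector_derivative xdd t) (at t within {t0..}))) \<and>
        (\<forall>t\<ge>t0. (xdd has_integral (xd t - xd t0)) {t0..t}) \<and>
        (\<exists>N. negligible N \<and> (\<forall>t\<in>{t0..} - N.
            (\<alpha> / t powr q) *\<^sub>R xd t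
            + proj0 ((\<lambda>c. c + (\<beta> / t powr p) *\<^sub>R x t + xdd t) ` Cset grad (x t)) = 0)) \<and>
        x t0 = x0 \<and> xd t0 = v0)"

definition A3 :: "('i::finite \<Rightarrow> 'a \<Rightarrow> real) \<Rightarrow> real \<Rightarrow> real \<Rightarrow> real \<Rightarrow> 'a::real_normed_vector \<Rightarrow> 'a \<Rightarrow> bool" where
  "A3 f t0 \<beta> p x0 v0 \<longleftrightarrow>
     (let a = \<beta> / (2 * t0 powr p) * (norm x0)\<^sup>2 + (1/2) * (norm v0)\<^sup>2;
          L0 = sublevel f (\<lambda>i. f i x0 + a) in
      (\<forall>x\<in>L0. LPw f (\<lambda>i. f i x) \<noteq> {}) \<and>
      bdd_above ((\<lambda>y. INF z\<in>{z. \<forall>i. f i z = f i y}. norm z) ` LPw f (\<lambda>i. f i x0 + a)))"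

definition Sw :: "('i::finite \<Rightarrow> 'a \<Rightarrow> real) \<Rightarrow> real^'i \<Rightarrow> 'a set" where
  "Sw f w = {z. \<forall>y. Max (range (\<lambda>i. f i z - w $ i)) \<le> Max (range (\<lambda>i. f i y - w $ i))}"

definition A4 :: "('i::finite \<Rightarrow> 'a::real_inner \<Rightarrow> real) \<Rightarrow> bool" where
  "A4 f \<longleftrightarrow> (\<forall>w. Sw f w \<noteq> {}) \<and> continuous_on UNIV (\<lambda>w. proj0 (Sw f w))"

end

theory Submission
  imports Defs
begin

text \<open>Write \<open>eps = beta / t powr p\<close>. The energies \<open>f i (x t) + eps/2 |x|\<^sup>2 + 1/2 |x'|\<^sup>2\<close> are nonincreasing with a
  dissipation that does not depend on \<open>i\<close>. For a fixed anchor \<open>z\<close>, their minimum over \<open>i\<close> relative to \<open>z\<close>,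
  corrected by a cross term in \<open>(x - z) \<bullet> x'\<close>, decays at a rate \<open>t powr - r\<close> with \<open>r < 1\<close> (this is
  where \<open>p < q + 1\<close> enters) up to a forcing of order \<open>t powr (- p - 1)\<close>, hence is \<open>o(eps)\<close>, uniformly for \<open>z\<close>
  in a ball. Uniformity allows anchors that move with \<open>t\<close> without ever being differentiated: \<open>z = x t\<close>
  gives \<open>x' \<rightarrow> 0\<close> and convergence of the values \<open>f i (x t)\<close>, and \<open>z = proj0 (Sw f (f (x t)))\<close>, which
  converges by (A4), gives \<open>limsup |x t| \<le> |proj0 (Sw f w)|\<close> for the limit values \<open>w\<close>. As \<open>x t\<close>
  eventually enters every sublevel set \<open>f i \<le> w i + 1/n\<close>, the parallelogram law yields strong convergence.\<close>

subsection \<open>Minimal norm elements of closed convex sets\<close>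

text \<open>Parallelogram law: the midpoint of \<open>a\<close> and \<open>b\<close> lies in
  \<open>S\<close>, so its norm is at least \<open>infdist 0 S\<close>. Two points of
  \<open>S\<close> whose norms are nearly minimal are therefore close to each other.\<close>

lemma dist_sq_le_infdist:
  fixes S :: "'a::real_inner set"
  assumes "convex S" "a \<in> S" "b \<in> S"
  shows "(dist a b)\<^sup>2 \<le> 2 * (norm a)\<^sup>2 + 2 * (norm b)\<^sup>2 - 4 * (infdist 0 S)\<^sup>2"
proof -
  have "(1/2) *\<^sub>R a + (1/2) *\<^sub>R b \<in> S"
    using assms by (intro convexD) auto
  then have "infdist 0 S \<le> norm ((1/2) *\<^sub>R a + (1/2) *\<^sub>R b)"
    using infdist_le[of _ S 0] by force
  then have "(infdist 0 S)\<^sup>2 \<le> (norm ((1/2) *\<^sub>R a + (1/2) *\<^sub>R b))\<^sup>2"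
    by (intro power_mono infdist_nonneg)
  also have "4 * \<dots> = 2 * (norm a)\<^sup>2 + 2 * (norm b)\<^sup>2 - (dist a b)\<^sup>2"
    by (simp add: power2_norm_eq_inner dist_norm inner_simps inner_commute)
  finally show ?thesis by simp
qed

text \<open>The distances from the origin increase with \<open>n\<close> and stay below
  \<open>B\<close>, so they converge. Near-minimisers chosen from each \<open>C n\<close> form a
  Cauchy sequence by the parallelogram law, and their limit lies in every \<open>C n\<close>.
  Completeness and convexity thus do the work that weak compactness would do.\<close>

lemma infdist_decseq_convex_tendsto:
  fixes C :: "nat \<Rightarrow> 'a::{real_inner, complete_space} set"
  assumes cl: "\<And>n. closed (C n)" and cv: "\<And>n. convex (C n)" and dec: "decseq C"
    and bd: "\<And>n. \<exists>y\<in>C n. norm y \<le> B"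
  shows "\<exists>z\<in>(\<Inter>n. C n). (\<lambda>n. infdist 0 (C n)) \<longlonglongrightarrow> norm z"
proof -
  define d where "d n = infdist 0 (C n)" for n
  have ne: "C n \<noteq> {}" for n using bd[of n] by auto
  have "incseq d"
    unfolding d_def using dec ne by (intro monoI infdist_mono) (auto dest: decseqD)
  moreover have "d n \<le> B" for n
    using bd[of n] infdist_le[of _ "C n" 0] unfolding d_def by force
  ultimately obtain D where D: "d \<longlonglongrightarrow> D" "\<And>n. d n \<le> D"
    using incseq_convergent[of d B] by auto
  have "\<exists>y\<in>C n. norm y < d n + 1 / Suc n" for n
    using ne[of n] cInf_lessD[of "dist 0 ` C n" "d n + 1 / Suc n"]
    unfolding d_def infdist_notempty[OF ne] by auto
  then obtain y where y: "\<And>n. y n \<in> C n" "\<And>n. norm (y n) < d n + 1 / Suc n"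
    by metis
  have dy: "d n \<le> norm (y n)" for n
    using infdist_le[OF y(1), of 0 n] by (simp add: d_def)
  have lim0: "(\<lambda>n. d n + 1 / Suc n) \<longlonglongrightarrow> D"
    using tendsto_add[OF D(1) lim_inverse_n'[THEN LIMSEQ_Suc]] by simp
  have ny: "(\<lambda>n. norm (y n)) \<longlonglongrightarrow> D"
    by (rule tendsto_sandwich[OF _ _ D(1) lim0]) (use dy y(2) in \<open>auto intro!: always_eventually less_imp_le\<close>)
  have "Cauchy y"
    unfolding Cauchy_altdef2
  proof (intro allI impI)
    fix e :: real assume e: "e > 0"
    have "(\<lambda>n. (norm (y n))\<^sup>2 - (d n)\<^sup>2) \<longlonglongrightarrow> D\<^sup>2 - D\<^sup>2"
      and nyD: "(\<lambda>n. (norm (y n))\<^sup>2) \<longlonglongrightarrow> D\<^sup>2"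
      by (intro tendsto_intros ny D)+
    then have "\<forall>\<^sub>F n in sequentially. (norm (y n))\<^sup>2 - (d n)\<^sup>2 < e\<^sup>2 / 8"
      using e by (intro order_tendstoD(2)) auto
    moreover have "\<forall>\<^sub>F n in sequentially. dist ((norm (y n))\<^sup>2) (D\<^sup>2) < e\<^sup>2 / 8"
      using e by (intro tendstoD nyD) auto
    ultimately have "\<forall>\<^sub>F n in sequentially. (norm (y n))\<^sup>2 - (d n)\<^sup>2 < e\<^sup>2 / 8 \<and> dist ((norm (y n))\<^sup>2) (D\<^sup>2) < e\<^sup>2 / 8"
      by (rule eventually_conj)
    then obtain N where N: "\<And>n. n \<ge> N \<Longrightarrow> (norm (y n))\<^sup>2 - (d n)\<^sup>2 < e\<^sup>2 / 8"
      "\<And>n. n \<ge> N \<Longrightarrow> dist ((norm (y n))\<^sup>2) (D\<^sup>2) < e\<^sup>2 / 8"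
      unfolding eventually_sequentially by blast
    show "\<exists>N. \<forall>n\<ge>N. dist (y n) (y N) < e"
    proof (intro exI allI impI)
      fix n assume n: "n \<ge> N"
      have "y n \<in> C N" using y(1)[of n] decseqD[OF dec n] by auto
      then have "(dist (y n) (y N))\<^sup>2 \<le> 2 * (norm (y n))\<^sup>2 + 2 * (norm (y N))\<^sup>2 - 4 * (d N)\<^sup>2"
        unfolding d_def by (intro dist_sq_le_infdist cv y)
      \<comment> \<open>The bound is
        \<open>2 (|y n|^2 - D^2) + 2 (D^2 - |y N|^2) + 4 (|y N|^2 - d N^2)\<close>, whence the
        tolerance \<open>e^2 / 8\<close>: the three terms contribute a quarter, a quarter and a half
        of \<open>e^2\<close>.\<close>
      also have "\<dots> < e\<^sup>2"
        using N(1)[of N] N(2)[of N] N(2)[OF n] unfolding dist_real_def abs_diff_less_iff by simp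
      finally show "dist (y n) (y N) < e"
        using e by (simp add: power_less_imp_less_base)
    qed
  qed
  then obtain z where z: "y \<longlonglongrightarrow> z" using Cauchy_convergent convergent_def by blast
  have "z \<in> C n" for n
  proof (rule closed_sequentially[OF cl[of n]])
    show "y (k + n) \<in> C n" for k using y(1) decseqD[OF dec le_add2[of n]] by blast
    show "(\<lambda>k. y (k + n)) \<longlonglongrightarrow> z" using z by (rule LIMSEQ_ignore_initial_segment)
  qed
  moreover have "norm z = D"
    using LIMSEQ_unique[OF tendsto_norm[OF z] ny] .
  ultimately show ?thesis using D(1) unfolding d_def by auto
qed

lemma min_norm_exists:
  fixes S :: "'a::{real_inner, complete_space} set"
  assumes "closed S" "convex S" "S \<noteq> {}"
  shows "\<exists>z\<in>S. \<forall>w\<in>S. norm z \<le> norm w"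
proof -
  obtain y where "y \<in> S" using assms by auto
  then obtain z where "z \<in> S" "(\<lambda>n::nat. infdist 0 S) \<longlonglongrightarrow> norm z"
    using infdist_decseq_convex_tendsto[of "\<lambda>_. S" "norm y"] assms by (auto simp: decseq_def)
  then show ?thesis
    using infdist_le[of _ S 0] by (force simp: LIMSEQ_const_iff)
qed

lemma min_norm_unique:
  fixes S :: "'a::real_inner set"
  assumes "convex S" "z \<in> S" "\<And>w. w \<in> S \<Longrightarrow> norm z \<le> norm w" "y \<in> S" "norm y \<le> norm z"
  shows "y = z"
proof -
  have "S \<noteq> {}" using assms by auto
  then have "norm z \<le> infdist 0 S"
    unfolding infdist_notempty[OF \<open>S \<noteq> {}\<close>] using assms(3) by (intro cINF_greatest) auto
  then have "(norm z)\<^sup>2 \<le> (infdist 0 S)\<^sup>2" "(norm y)\<^sup>2 \<le> (norm z)\<^sup>2"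
    using assms(5) by (auto intro!: power_mono)
  with dist_sq_le_infdist[OF assms(1,2,4)] have "(dist z y)\<^sup>2 \<le> 0" by linarith
  then show ?thesis by simp
qed

text \<open>Existence and uniqueness of the minimiser give the definite description in
  \<open>proj0\<close> its intended meaning; all later facts about \<open>proj0\<close> come through
  here.\<close>

lemma proj0_min_norm:
  fixes S :: "'a::{real_inner, complete_space} set"
  assumes "closed S" "convex S" "S \<noteq> {}"
  shows "proj0 S \<in> S" "\<And>w. w \<in> S \<Longrightarrow> norm (proj0 S) \<le> norm w"
proof -
  obtain z where z: "z \<in> S" "\<forall>w\<in>S. norm z \<le> norm w"
    using min_norm_exists[OF assms] by auto
  have "proj0 S \<in> S \<and> (\<forall>w\<in>S. norm (proj0 S) \<le> norm w)"
    unfolding proj0_def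
    by (rule theI[of _ z]) (use z min_norm_unique[OF assms(2) z(1)] in auto)
  then show "proj0 S \<in> S" "\<And>w. w \<in> S \<Longrightarrow> norm (proj0 S) \<le> norm w" by auto
qed

text \<open>Variational inequality for the projection of the origin. This is the form in which the
  differential inclusion enters the energy estimate.\<close>

lemma proj0_inner_ge:
  fixes S :: "'a::{real_inner, complete_space} set"
  assumes "closed S" "convex S" "w \<in> S"
  shows "proj0 S \<bullet> (w - proj0 S) \<ge> 0"
proof -
  have "S \<noteq> {}" using assms by auto
  note P = proj0_min_norm[OF assms(1,2) this]
  show ?thesis
    using any_closest_point_dot[OF assms(2,1) P(1) assms(3), of 0] P(2) by auto
qed

text \<open>The distances of the \<open>C n\<close> from the origin tend to \<open>norm z\<close>.
  Once \<open>n\<close> is fixed with this distance close to \<open>norm z\<close>, both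
  \<open>z\<close> and eventually \<open>x t\<close> lie in \<open>C n\<close> with nearly minimal
  norm, so the parallelogram law brings them together.\<close>

lemma tendsto_min_norm_decseq_convex:
  fixes C :: "nat \<Rightarrow> 'a::{real_inner, complete_space} set" and x :: "'b \<Rightarrow> 'a"
  assumes cl: "\<And>n. closed (C n)" and cv: "\<And>n. convex (C n)" and dec: "decseq C"
    and z: "z \<in> (\<Inter>n. C n)" "\<And>y. y \<in> (\<Inter>n. C n) \<Longrightarrow> norm z \<le> norm y"
    and x: "\<And>n. \<forall>\<^sub>F t in F. x t \<in> C n" "\<And>e. e > 0 \<Longrightarrow> \<forall>\<^sub>F t in F. (norm (x t))\<^sup>2 < (norm z)\<^sup>2 + e"
  shows "(x \<longlongrightarrow> z) F"
proof (rule tendstoI)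
  fix e :: real assume e: "e > 0"
  obtain y where y: "y \<in> (\<Inter>n. C n)" "(\<lambda>n. infdist 0 (C n)) \<longlonglongrightarrow> norm y"
    using infdist_decseq_convex_tendsto[OF cl cv dec, of "norm z"] z(1) by blast
  \<comment> \<open>The point \<open>y\<close> supplied by the previous lemma is some point of the
    intersection; only the equality of its norm with that of \<open>z\<close> is used.\<close>
  have "norm y \<le> norm z"
    by (rule LIMSEQ_le_const2[OF y(2)]) (use z(1) infdist_le[of z _ 0] in auto)
  then have "norm y = norm z" using z(2)[OF y(1)] by simp
  then have "(\<lambda>n. (infdist 0 (C n))\<^sup>2) \<longlonglongrightarrow> (norm z)\<^sup>2"
    using y(2) by (auto intro!: tendsto_intros)
  then have "\<forall>\<^sub>F n in sequentially. (infdist 0 (C n))\<^sup>2 > (norm z)\<^sup>2 - e\<^sup>2 / 8"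
    using e by (intro order_tendstoD) auto
  then obtain n where n: "(infdist 0 (C n))\<^sup>2 > (norm z)\<^sup>2 - e\<^sup>2 / 8"
    unfolding eventually_sequentially by blast
  have "e\<^sup>2 / 8 > 0" using e by simp
  from x(1)[of n] x(2)[OF this] show "\<forall>\<^sub>F t in F. dist (x t) z < e"
  proof eventually_elim
    case (elim t)
    have "(dist (x t) z)\<^sup>2 \<le> 2 * (norm (x t))\<^sup>2 + 2 * (norm z)\<^sup>2 - 4 * (infdist 0 (C n))\<^sup>2"
      using z(1) by (intro dist_sq_le_infdist cv elim) auto
    also have "\<dots> < e\<^sup>2" using n elim(2) \<open>e\<^sup>2 / 8 > 0\<close> by linarith
    finally show ?case using e by (simp add: power_less_imp_less_base)
  qed
qed

subsection \<open>Absolutely continuous functions\<close>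

lemma lipschitz_on_imp_abs_cont_on:
  assumes "L-lipschitz_on {a..b} g"
  shows "abs_cont_on a b g"
  unfolding abs_cont_on_def
proof (intro allI impI)
  fix e :: real assume e: "e > 0"
  have L: "L \<ge> 0" using assms lipschitz_on_nonneg by blast
  show "\<exists>\<delta>>0. \<forall>n::nat. \<forall>l r :: nat \<Rightarrow> real.
        (\<forall>k<n. a \<le> l k \<and> l k \<le> r k \<and> r k \<le> b) \<longrightarrow>
        (\<forall>j<n. \<forall>k<n. j \<noteq> k \<longrightarrow> r j \<le> l k \<or> r k \<le> l j) \<longrightarrow>
        (\<Sum>k<n. r k - l k) < \<delta> \<longrightarrow>
        (\<Sum>k<n. norm (g (r k) - g (l k))) < e"
  proof (intro exI[of _ "e / (L + 1)"] conjI allI impI)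
    fix n and l r :: "nat \<Rightarrow> real"
    assume lr: "\<forall>k<n. a \<le> l k \<and> l k \<le> r k \<and> r k \<le> b" and s: "(\<Sum>k<n. r k - l k) < e / (L + 1)"
    have "(\<Sum>k<n. norm (g (r k) - g (l k))) \<le> (\<Sum>k<n. L * (r k - l k))"
    proof (rule sum_mono)
      fix k assume "k \<in> {..<n}"
      then show "norm (g (r k) - g (l k)) \<le> L * (r k - l k)"
        using lipschitz_on_normD[OF assms, of "r k" "l k"] lr[rule_format, of k] by auto
    qed
    also have "\<dots> \<le> (L + 1) * (\<Sum>k<n. r k - l k)"
      using lr by (simp only: sum_distrib_left[symmetric]) (intro mult_right_mono sum_nonneg, auto)
    also have "\<dots> < e" using s L by (simp add: field_simps)
    finally show "(\<Sum>k<n. norm (g (r k) - g (l k))) < e" .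
  qed (use e L in auto)
qed

lemma C1_imp_abs_cont_on:
  fixes g :: "real \<Rightarrow> 'a::real_normed_vector"
  assumes "\<And>t. t \<in> {a..b} \<Longrightarrow> (g has_vector_derivative g' t) (at t within {a..b})"
    and "continuous_on {a..b} g'"
  shows "abs_cont_on a b g"
proof -
  have "bounded (g' ` {a..b})"
    using assms(2) by (intro compact_imp_bounded compact_continuous_image) auto
  then obtain B where B: "\<And>t. t \<in> {a..b} \<Longrightarrow> norm (g' t) \<le> B" "B > 0"
    unfolding bounded_pos by blast
  have "B-lipschitz_on {a..b} g"
    by (rule bounded_derivative_imp_lipschitz[OF assms(1)[unfolded has_vector_derivative_def]])
      (use B in \<open>auto intro!: onorm_bound mult_left_mono simp: mult.commute[of B]\<close>)
  then show ?thesis by (rule lipschitz_on_imp_abs_cont_on)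
qed

lemma abs_cont_on_subset:
  assumes "abs_cont_on a b g" "a \<le> c" "d \<le> b"
  shows "abs_cont_on c d g"
  unfolding abs_cont_on_def
proof (intro allI impI)
  fix e :: real assume "e > 0"
  then obtain \<delta> where d: "\<delta> > 0" and h: "\<forall>n::nat. \<forall>l r :: nat \<Rightarrow> real.
        (\<forall>k<n. a \<le> l k \<and> l k \<le> r k \<and> r k \<le> b) \<longrightarrow>
        (\<forall>j<n. \<forall>k<n. j \<noteq> k \<longrightarrow> r j \<le> l k \<or> r k \<le> l j) \<longrightarrow>
        (\<Sum>k<n. r k - l k) < \<delta> \<longrightarrow> (\<Sum>k<n. norm (g (r k) - g (l k))) < e"
    using assms(1) unfolding abs_cont_on_def by blast
  show "\<exists>\<delta>>0. \<forall>n::nat. \<forall>l r :: nat \<Rightarrow> real.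
        (\<forall>k<n. c \<le> l k \<and> l k \<le> r k \<and> r k \<le> d) \<longrightarrow>
        (\<forall>j<n. \<forall>k<n. j \<noteq> k \<longrightarrow> r j \<le> l k \<or> r k \<le> l j) \<longrightarrow>
        (\<Sum>k<n. r k - l k) < \<delta> \<longrightarrow> (\<Sum>k<n. norm (g (r k) - g (l k))) < e"
  proof (intro exI[of _ \<delta>] conjI allI impI d)
    fix n and l r :: "nat \<Rightarrow> real"
    assume "\<forall>k<n. c \<le> l k \<and> l k \<le> r k \<and> r k \<le> d" and o: "\<forall>j<n. \<forall>k<n. j \<noteq> k \<longrightarrow> r j \<le> l k \<or> r k \<le> l j"
      and s: "(\<Sum>k<n. r k - l k) < \<delta>"
    then have "\<forall>k<n. a \<le> l k \<and> l k \<le> r k \<and> r k \<le> b" using assms(2,3) by force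
    then show "(\<Sum>k<n. norm (g (r k) - g (l k))) < e" using h o s by blast
  qed
qed

text \<open>Common source of the closure properties below: sums, differences and inner products all
  have increments controlled by those of the two operands.\<close>

lemma abs_cont_on_dominated2:
  assumes g: "abs_cont_on a b g" and h: "abs_cont_on a b h" and K: "K > 0"
    and dom: "\<And>u v. a \<le> u \<Longrightarrow> u \<le> v \<Longrightarrow> v \<le> b \<Longrightarrow>
      norm (k v - k u) \<le> K * (norm (g v - g u) + norm (h v - h u))"
  shows "abs_cont_on a b k"
  unfolding abs_cont_on_def
proof (intro allI impI)
  fix e :: real assume "e > 0"
  then have e: "e / (2 * K) > 0" using K by simp
  obtain \<delta>1 where d1: "\<delta>1 > 0" "\<forall>n::nat. \<forall>l r :: nat \<Rightarrow> real.
        (\<forall>k<n. a \<le> l k \<and> l k \<le> r k \<and> r k \<le> b) \<longrightarrow>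
        (\<forall>j<n. \<forall>k<n. j \<noteq> k \<longrightarrow> r j \<le> l k \<or> r k \<le> l j) \<longrightarrow>
        (\<Sum>k<n. r k - l k) < \<delta>1 \<longrightarrow> (\<Sum>k<n. norm (g (r k) - g (l k))) < e / (2 * K)"
    using g[unfolded abs_cont_on_def, rule_format, OF e] by blast
  obtain \<delta>2 where d2: "\<delta>2 > 0" "\<forall>n::nat. \<forall>l r :: nat \<Rightarrow> real.
        (\<forall>k<n. a \<le> l k \<and> l k \<le> r k \<and> r k \<le> b) \<longrightarrow>
        (\<forall>j<n. \<forall>k<n. j \<noteq> k \<longrightarrow> r j \<le> l k \<or> r k \<le> l j) \<longrightarrow>
        (\<Sum>k<n. r k - l k) < \<delta>2 \<longrightarrow> (\<Sum>k<n. norm (h (r k) - h (l k))) < e / (2 * K)"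
    using h[unfolded abs_cont_on_def, rule_format, OF e] by blast
  show "\<exists>\<delta>>0. \<forall>n::nat. \<forall>l r :: nat \<Rightarrow> real.
        (\<forall>k<n. a \<le> l k \<and> l k \<le> r k \<and> r k \<le> b) \<longrightarrow>
        (\<forall>j<n. \<forall>k<n. j \<noteq> k \<longrightarrow> r j \<le> l k \<or> r k \<le> l j) \<longrightarrow>
        (\<Sum>k<n. r k - l k) < \<delta> \<longrightarrow> (\<Sum>j<n. norm (k (r j) - k (l j))) < e"
  proof (intro exI[of _ "min \<delta>1 \<delta>2"] conjI allI impI)
    fix n and l r :: "nat \<Rightarrow> real"
    assume lr: "\<forall>k<n. a \<le> l k \<and> l k \<le> r k \<and> r k \<le> b" 
      and o: "\<forall>j<n. \<forall>k<n. j \<noteq> k \<longrightarrow> r j \<le> l k \<or> r k \<le> l j"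
      and s: "(\<Sum>k<n. r k - l k) < min \<delta>1 \<delta>2"
    have "(\<Sum>j<n. norm (k (r j) - k (l j)))
        \<le> (\<Sum>j<n. K * (norm (g (r j) - g (l j)) + norm (h (r j) - h (l j))))"
      using lr by (intro sum_mono dom) auto
    also have "\<dots> = K * ((\<Sum>j<n. norm (g (r j) - g (l j))) + (\<Sum>j<n. norm (h (r j) - h (l j))))"
      by (simp add: sum_distrib_left[symmetric] sum.distrib)
    also have "\<dots> < K * (e / (2 * K) + e / (2 * K))"
      using lr o s d1(2) d2(2) K by (intro mult_strict_left_mono add_strict_mono) auto
    also have "\<dots> = e" using K by simp
    finally show "(\<Sum>j<n. norm (k (r j) - k (l j))) < e" .
  qed (use d1 d2 in auto)
qed

lemma abs_cont_on_add:
  assumes "abs_cont_on a b g" "abs_cont_on a b h"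
  shows "abs_cont_on a b (\<lambda>t. g t + h t)"
  by (rule abs_cont_on_dominated2[OF assms, of 1])
    (use norm_diff_triangle_ineq in auto)

lemma abs_cont_on_diff:
  assumes "abs_cont_on a b g" "abs_cont_on a b h"
  shows "abs_cont_on a b (\<lambda>t. g t - h t)"
proof (rule abs_cont_on_dominated2[OF assms, of 1])
  fix u v
  have "g v - h v - (g u - h u) = (g v - g u) - (h v - h u)" by simp
  then show "norm (g v - h v - (g u - h u)) \<le> 1 * (norm (g v - g u) + norm (h v - h u))"
    by (simp only: mult_1) (rule norm_triangle_ineq4)
qed simp

lemma abs_cont_on_const: "abs_cont_on a b (\<lambda>t. c)"
  by (rule lipschitz_on_imp_abs_cont_on[of 0]) (simp add: lipschitz_on_def)

lemma abs_cont_on_imp_continuous_on: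
  assumes "abs_cont_on a b g"
  shows "continuous_on {a..b} g"
  unfolding continuous_on_iff
proof (intro ballI allI impI)
  fix s and e :: real assume s: "s \<in> {a..b}" and e: "e > 0"
  obtain \<delta> where d: "\<delta> > 0" and h: "\<forall>n::nat. \<forall>l r :: nat \<Rightarrow> real.
        (\<forall>k<n. a \<le> l k \<and> l k \<le> r k \<and> r k \<le> b) \<longrightarrow>
        (\<forall>j<n. \<forall>k<n. j \<noteq> k \<longrightarrow> r j \<le> l k \<or> r k \<le> l j) \<longrightarrow>
        (\<Sum>k<n. r k - l k) < \<delta> \<longrightarrow> (\<Sum>k<n. norm (g (r k) - g (l k))) < e"
    using assms[unfolded abs_cont_on_def, rule_format, OF e] by blast
  have *: "norm (g v - g u) < e" if "a \<le> u" "u \<le> v" "v \<le> b" "v - u < \<delta>" for u v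
    using h[rule_format, of 1 "\<lambda>_. u" "\<lambda>_. v"] that by simp
  show "\<exists>d>0. \<forall>t\<in>{a..b}. dist t s < d \<longrightarrow> dist (g t) (g s) < e"
  proof (intro exI[of _ \<delta>] conjI d ballI impI)
    fix t assume "t \<in> {a..b}" "dist t s < \<delta>"
    then show "dist (g t) (g s) < e"
      using *[of s t] *[of t s] s by (cases "s \<le> t") (auto simp: dist_norm norm_minus_commute)
  qed
qed

lemma abs_cont_on_inner:
  fixes g h :: "real \<Rightarrow> 'a::real_inner"
  assumes "abs_cont_on a b g" "abs_cont_on a b h"
  shows "abs_cont_on a b (\<lambda>t. g t \<bullet> h t)"
proof -
  have "bounded (g ` {a..b} \<union> h ` {a..b})"
    unfolding bounded_Un using assms
    by (intro conjI compact_imp_bounded compact_continuous_image abs_cont_on_imp_continuous_on) auto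
  then obtain B where B: "B > 0" "\<And>t. t \<in> {a..b} \<Longrightarrow> norm (g t) \<le> B" "\<And>t. t \<in> {a..b} \<Longrightarrow> norm (h t) \<le> B"
    unfolding bounded_pos by auto
  show ?thesis
  proof (rule abs_cont_on_dominated2[OF assms(1,2) B(1)])
    fix u v assume uv: "a \<le> u" "u \<le> v" "v \<le> b"
    have "g v \<bullet> h v - g u \<bullet> h u = (g v - g u) \<bullet> h v + g u \<bullet> (h v - h u)"
      by (simp add: inner_simps)
    also have "norm \<dots> \<le> norm (g v - g u) * norm (h v) + norm (g u) * norm (h v - h u)"
      using Cauchy_Schwarz_ineq2[of "g v - g u" "h v"] Cauchy_Schwarz_ineq2[of "g u" "h v - h u"] by simp
    also have "\<dots> \<le> norm (g v - g u) * B + B * norm (h v - h u)"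
      using uv using B(1) by (intro add_mono mult_mono B) auto
    finally show "norm (g v \<bullet> h v - g u \<bullet> h u) \<le> B * (norm (g v - g u) + norm (h v - h u))"
      by (simp add: algebra_simps)
  qed
qed

lemma abs_cont_on_mult:
  fixes g h :: "real \<Rightarrow> real"
  assumes "abs_cont_on a b g" "abs_cont_on a b h"
  shows "abs_cont_on a b (\<lambda>t. g t * h t)"
  using abs_cont_on_inner[OF assms] by simp

text \<open>Cousin's lemma: the tags outside the exceptional set are controlled by the derivative, the
  others by absolute continuity, because the indicator of a negligible set has Henstock integral 0.\<close>
lemma abs_cont_on_nonincreasing:
  fixes g :: "real \<Rightarrow> real"
  assumes ab: "a \<le> b" and ac: "abs_cont_on a b g" and N: "negligible N"
    and der: "\<And>t. t \<in> {a..b} - N \<Longrightarrow> \<exists>d\<le>0. (g has_vector_derivative d) (at t within {a..b})"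
  shows "g b \<le> g a"
proof (rule field_le_epsilon)
  fix e' :: real assume e': "e' > 0"
  \<comment> \<open>Tags outside \<open>N\<close> will contribute at most \<open>e * (b - a)\<close>
    and tags in \<open>N\<close> at most \<open>e\<close>, which adds up to
    \<open>e'\<close>.\<close>
  define e where "e = e' / (b - a + 1)"
  have e: "e > 0" using e' ab by (simp add: e_def)
  have "e * (b - a + 1) = e'" using ab by (simp add: e_def)
  then have ee': "e * (b - a) + e = e'" by (simp add: algebra_simps)
  obtain \<delta> where \<delta>: "\<delta> > 0" "\<forall>n::nat. \<forall>l r :: nat \<Rightarrow> real.
        (\<forall>k<n. a \<le> l k \<and> l k \<le> r k \<and> r k \<le> b) \<longrightarrow>
        (\<forall>j<n. \<forall>k<n. j \<noteq> k \<longrightarrow> r j \<le> l k \<or> r k \<le> l j) \<longrightarrow>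
        (\<Sum>k<n. r k - l k) < \<delta> \<longrightarrow> (\<Sum>k<n. norm (g (r k) - g (l k))) < e"
    using ac[unfolded abs_cont_on_def, rule_format, OF e] by blast
  have "((indicator N :: real \<Rightarrow> real) has_integral 0) (cbox a b)"
    using N by (simp add: negligible_def)
  then obtain \<gamma> where \<gamma>: "gauge \<gamma>" "\<And>D. D tagged_division_of cbox a b \<Longrightarrow> \<gamma> fine D \<Longrightarrow>
      norm ((\<Sum>(x,K)\<in>D. Henstock_Kurzweil_Integration.content K *\<^sub>R (indicator N x :: real)) - 0) < \<delta>"
    using \<delta>(1) unfolding has_integral by meson
  \<comment> \<open>Straddle estimate: the increments on the two sides of the tag \<open>t\<close>
    are compared with the derivative at \<open>t\<close> separately, and the linear term is then
    discarded because \<open>c \<le> 0\<close>.\<close>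
  have "\<exists>d>0. t \<in> {a..b} - N \<longrightarrow> (\<forall>u v. a \<le> u \<and> u \<le> t \<and> t \<le> v \<and> v \<le> b \<and> t - u < d \<and> v - t < d \<longrightarrow> g v - g u \<le> e * (v - u))" for t
  proof (cases "t \<in> {a..b} - N")
    case True
    then obtain c where c: "c \<le> 0" "(g has_vector_derivative c) (at t within {a..b})" using der by blast
    obtain d where d: "d > 0" "\<And>y. y \<in> {a..b} \<Longrightarrow> norm (y - t) < d \<Longrightarrow> norm (g y - g t - (y - t) *\<^sub>R c) \<le> e * norm (y - t)"
      using c(2) e unfolding has_vector_derivative_def has_derivative_within_alt by blast
    show ?thesis
    proof (intro exI[of _ d] conjI impI allI d(1))
      fix u v assume uv: "a \<le> u \<and> u \<le> t \<and> t \<le> v \<and> v \<le> b \<and> t - u < d \<and> v - t < d"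
      have "norm (g v - g t - (v - t) *\<^sub>R c) \<le> e * norm (v - t)" "norm (g u - g t - (u - t) *\<^sub>R c) \<le> e * norm (u - t)"
        using d(2)[of v] d(2)[of u] uv by auto
      then have "g v - g t - (v - t) * c \<le> e * (v - t)" "- (g u - g t - (u - t) * c) \<le> e * (t - u)"
        using uv by (auto simp: abs_le_iff abs_if split: if_splits)
      then have "g v - g u \<le> e * (v - u) + c * (v - u)" by (simp add: algebra_simps)
      moreover have "c * (v - u) \<le> 0" using c uv by (simp add: mult_nonpos_nonneg)
      ultimately show "g v - g u \<le> e * (v - u)" by simp
    qed
  qed (auto intro: exI[of _ 1])
  then obtain d where d: "\<And>t. d t > (0::real)" "\<And>t u v. t \<in> {a..b} - N \<Longrightarrow>
      a \<le> u \<and> u \<le> t \<and> t \<le> v \<and> v \<le> b \<and> t - u < d t \<and> v - t < d t \<Longrightarrow> g v - g u \<le> e * (v - u)" by metis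
  have "gauge (\<lambda>t. \<gamma> t \<inter> ball t (d t))"
    by (intro gauge_Int \<gamma>(1) gauge_ball_dependent) (use d in auto)
  then obtain p where p: "p tagged_division_of {a..b}" "(\<lambda>t. \<gamma> t \<inter> ball t (d t)) fine p"
    using fine_division_exists_real by blast
  have fin: "finite p" using p(1) by blast
  have K: "\<exists>l r. K = {l..r} \<and> a \<le> l \<and> l \<le> t \<and> t \<le> r \<and> r \<le> b \<and> Inf K = l \<and> Sup K = r \<and> t - l < d t \<and> r - t < d t"
    if "(t,K) \<in> p" for t K
  proof -
    have h: "t \<in> K" "K \<subseteq> {a..b}" "\<exists>l r. K = cbox l r" 
      using p(1) that unfolding tagged_division_of by blast+
    then obtain l r where lr: "K = {l..r}" by (auto simp: cbox_interval)
    have "K \<subseteq> ball t (d t)" using p(2) that unfolding fine_def by auto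
    moreover have "l \<in> K" "r \<in> K" using lr h(1) by auto
    ultimately have "l \<in> ball t (d t)" "r \<in> ball t (d t)" by blast+
    then show ?thesis using h lr by (intro exI[of _ l] exI[of _ r]) (auto simp: dist_real_def)
  qed
  \<comment> \<open>Degenerate intervals are left out: they contribute nothing, and for
    nondegenerate ones disjoint interiors really mean that one interval precedes the other.\<close>
  define P where "P = {x\<in>p. fst x \<in> N \<and> Inf (snd x) < Sup (snd x)}"
  have finP: "finite P" using fin by (simp add: P_def)
  have "g b - g a = (\<Sum>(x,K)\<in>p. g (Sup K) - g (Inf K))"
    using additive_tagged_division_1[OF ab p(1), of g] by simp
  also have "\<dots> = (\<Sum>(x,K)\<in>p - P. g (Sup K) - g (Inf K)) + (\<Sum>(x,K)\<in>P. g (Sup K) - g (Inf K))"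
    using fin by (intro sum.subset_diff) (auto simp: P_def)
  also have "(\<Sum>(x,K)\<in>p - P. g (Sup K) - g (Inf K)) \<le> (\<Sum>(x,K)\<in>p - P. e * (Sup K - Inf K))"
  proof (intro sum_mono, safe)
    fix t K assume tK: "(t,K) \<in> p" "(t,K) \<notin> P"
    show "g (Sup K) - g (Inf K) \<le> e * (Sup K - Inf K)"
    proof (cases "t \<in> N")
      case True
      then have "Inf K = Sup K" using K[OF tK(1)] tK by (auto simp: P_def)
      then show ?thesis by simp
    next
      case False
      then show ?thesis using K[OF tK(1)] by (intro d(2)[of t]) auto
    qed
  qed
  also have "\<dots> \<le> (\<Sum>(x,K)\<in>p. e * (Sup K - Inf K))"
    using fin K e by (intro sum_mono2) fastforce+
  also have "\<dots> = e * (\<Sum>(x,K)\<in>p. Sup K - Inf K)"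
    by (simp add: sum_distrib_left split_def)
  also have "(\<Sum>(x,K)\<in>p. Sup K - Inf K) = b - a"
    using additive_tagged_division_1[OF ab p(1), of "\<lambda>x. x"] by simp
  also have "(\<Sum>(x,K)\<in>P. g (Sup K) - g (Inf K)) < e"
  proof -
    obtain f where f: "bij_betw f {..<card P} P"
      using ex_bij_betw_nat_finite[OF finP] by (auto simp: atLeast0LessThan)
    define l where "l k = Inf (snd (f k))" for k
    define r where "r k = Sup (snd (f k))" for k
    have fp: "f k \<in> p" "f k \<in> P" if "k < card P" for k
      using bij_betwE[OF f] that by (auto simp: P_def)
    have fK: "snd (f k) = {l k..r k} \<and> a \<le> l k \<and> l k < r k \<and> r k \<le> b" if "k < card P" for k
      using K[of "fst (f k)" "snd (f k)"] fp[OF that] unfolding l_def r_def P_def by fastforce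
    have disj: "r j \<le> l k \<or> r k \<le> l j" if "j < card P" "k < card P" "j \<noteq> k" for j k
    proof -
      have "f j \<noteq> f k" using f that unfolding bij_betw_def inj_on_def by auto
      then have "(fst (f j), snd (f j)) \<noteq> (fst (f k), snd (f k))" by simp
      then have "interior (snd (f j)) \<inter> interior (snd (f k)) = {}"
        using p(1) fp(1)[OF that(1)] fp(1)[OF that(2)] unfolding tagged_division_of
        by (metis prod.collapse)
      then have *: "{l j<..<r j} \<inter> {l k<..<r k} = {}"
        using fK that by (simp add: interior_atLeastAtMost_real)
      show ?thesis
      proof (rule ccontr)
        assume "\<not> ?thesis"
        then have "max (l j) (l k) < min (r j) (r k)"
          using fK[OF that(1)] fK[OF that(2)] by auto
        then obtain c where "max (l j) (l k) < c" "c < min (r j) (r k)" using dense by blast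
        then show False using * by auto
      qed
    qed
    \<comment> \<open>The total length of the intervals tagged in \<open>N\<close> is the Riemann
      sum of the indicator of \<open>N\<close>, which the gauge \<open>\<gamma>\<close> keeps below
      \<open>\<delta>\<close>.\<close>
    have "(\<Sum>k<card P. r k - l k) = (\<Sum>x\<in>P. Sup (snd x) - Inf (snd x))"
      unfolding l_def r_def by (rule sum.reindex_bij_betw[OF f])
    also have "\<dots> = (\<Sum>(x,K)\<in>P. Henstock_Kurzweil_Integration.content K *\<^sub>R (indicator N x :: real))"
    proof (intro sum.cong refl)
      fix y assume y: "y \<in> P"
      then obtain t J where tJ: "y = (t, J)" "(t, J) \<in> p" "t \<in> N" by (cases y) (auto simp: P_def)
      from K[OF tJ(2)] obtain l r where "J = {l..r}" "l \<le> r" "Inf J = l" "Sup J = r" by auto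
      then show "Sup (snd y) - Inf (snd y) = (case y of (x,K) \<Rightarrow> Henstock_Kurzweil_Integration.content K *\<^sub>R indicator N x)"
        using tJ by simp
    qed
    also have "\<dots> = (\<Sum>(x,K)\<in>p. Henstock_Kurzweil_Integration.content K *\<^sub>R (indicator N x :: real))"
    proof (intro sum.mono_neutral_left fin ballI)
      fix y assume y: "y \<in> p - P"
      then obtain t J where tJ: "y = (t, J)" "(t, J) \<in> p" by (cases y) auto
      from K[OF tJ(2)] obtain l r where "J = {l..r}" "l \<le> r" "Inf J = l" "Sup J = r" by auto
      then show "(case y of (x,K) \<Rightarrow> Henstock_Kurzweil_Integration.content K *\<^sub>R (indicator N x :: real)) = 0"
        using y tJ by (auto simp: P_def indicator_def)
    qed (auto simp: P_def)
    also have "\<dots> < \<delta>"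
      using \<gamma>(2)[of p] p by (auto simp: cbox_interval fine_Int)
    finally have "(\<Sum>k<card P. norm (g (r k) - g (l k))) < e"
      using \<delta>(2)[rule_format, of "card P" l r] fK disj by (simp add: less_imp_le)
    moreover have "(\<Sum>k<card P. norm (g (r k) - g (l k))) = (\<Sum>x\<in>P. norm (g (Sup (snd x)) - g (Inf (snd x))))"
      unfolding l_def r_def by (rule sum.reindex_bij_betw[OF f])
    moreover have "(\<Sum>(x,K)\<in>P. g (Sup K) - g (Inf K)) \<le> (\<Sum>x\<in>P. norm (g (Sup (snd x)) - g (Inf (snd x))))"
      by (intro sum_mono) auto
    ultimately show ?thesis by simp
  qed
  finally show "g b \<le> g a + e'" using ee' by simp
qed

section \<open>Comparison principle for a minimum of finitely many functions\<close>

lemma continuous_on_Min: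
  fixes g :: "'i \<Rightarrow> 'b::topological_space \<Rightarrow> real"
  assumes "finite I" "I \<noteq> {}" "\<And>i. i \<in> I \<Longrightarrow> continuous_on S (g i)"
  shows "continuous_on S (\<lambda>t. Min ((\<lambda>i. g i t) ` I))"
  using assms
proof (induction rule: finite_ne_induct)
  case (insert i I)
  then have "(\<lambda>t. Min ((\<lambda>i. g i t) ` insert i I)) = (\<lambda>t. min (g i t) (Min ((\<lambda>i. g i t) ` I)))"
    by simp
  then show ?case using insert by (auto intro!: continuous_on_min)
qed simp

text \<open>The minimum is never differentiated. At the first time \<open>c\<close> at which it
  reaches \<open>V\<close>, the common upper bound on the derivatives of all \<open>Y i\<close> is
  smaller than \<open>V'\<close>, so each \<open>Y i - V\<close> is nonincreasing just before
  \<open>c\<close>. As all of these are nonnegative at \<open>c\<close>, they are nonnegative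
  slightly earlier, and the minimum would have reached \<open>V\<close> before \<open>c\<close>. The
  argument relies on the bound being the same for every \<open>i\<close>.\<close>

lemma Min_less_supersolution:
  fixes Y :: "'i::finite \<Rightarrow> real \<Rightarrow> real"
  assumes ac: "\<And>i T. T \<ge> a \<Longrightarrow> abs_cont_on a T (Y i)" and N: "negligible N"
    and der: "\<And>i t. t \<in> {a..} - N \<Longrightarrow> \<exists>d. (Y i has_real_derivative d) (at t within {a..})
      \<and> d \<le> F t - \<mu> t * (MIN j. Y j t)"
    and F: "continuous_on {a..} F" and \<mu>: "continuous_on {a..} \<mu>" "\<And>t. t \<ge> a \<Longrightarrow> \<mu> t \<ge> 0"
    and V: "\<And>t. t \<ge> a \<Longrightarrow> (V has_real_derivative V' t) (at t within {a..})" "continuous_on {a..} V'"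
    and super: "\<And>t. t \<ge> a \<Longrightarrow> F t - \<mu> t * V t < V' t"
    and init: "(MIN j. Y j a) < V a" and t: "t \<ge> a"
  shows "(MIN j. Y j t) < V t"
proof (rule ccontr)
  define m where "m s = (MIN j. Y j s)" for s
  assume "\<not> ?thesis"
  then have tm: "V t \<le> m t" unfolding m_def by (rule leI)
  have cV: "continuous_on {a..} V"
    using V(1) by (auto simp: continuous_on_eq_continuous_within dest: DERIV_continuous)
  have cm: "continuous_on {a..T} m" if "T \<ge> a" for T
    unfolding m_def by (intro continuous_on_Min abs_cont_on_imp_continuous_on ac that) auto
  \<comment> \<open>The set of times at which the minimum has reached \<open>V\<close>; it is
    closed, so its infimum is a first such time.\<close>
  define S where "S = {s\<in>{a..t}. m s - V s \<in> {0..}}"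
  have "closed S"
    unfolding S_def
    by (intro continuous_closed_preimage[unfolded vimage_def Int_def mem_Collect_eq] continuous_intros cm t
        continuous_on_subset[OF cV]) auto
  moreover have "S \<noteq> {}" "bdd_below S" using tm t by (auto simp: S_def intro!: bdd_belowI[of _ a])
  ultimately have c: "Inf S \<in> S" using closed_contains_Inf by blast
  define c where "c = Inf S"
  have c: "a \<le> c" "c \<le> t" "V c \<le> m c" using c by (auto simp: c_def S_def)
  have less: "m s < V s" if "a \<le> s" "s < c" for s
  proof (rule ccontr)
    assume "\<not> ?thesis"
    then have "s \<in> S" using that c by (auto simp: S_def)
    then have "c \<le> s" unfolding c_def using \<open>bdd_below S\<close> by (rule cInf_lower)
    then show False using that by simp
  qed
  have "m a < V a" unfolding m_def by (rule init)
  then have ac': "a < c" using c by (cases "a = c") auto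
  \<comment> \<open>\<open>B\<close> bounds the derivative of every \<open>Y i - V\<close>. It is
    negative at \<open>c\<close>, by \<open>V c \<le> m c\<close> and
    \<open>\<mu> c \<ge> 0\<close>, hence by continuity on some interval ending at
    \<open>c\<close>.\<close>
  define B where "B s = F s - \<mu> s * m s - V' s" for s
  have "continuous_on {a..c} B"
    unfolding B_def using c by (intro continuous_intros cm continuous_on_subset[OF F] continuous_on_subset[OF V(2)]
        continuous_on_subset[OF \<mu>(1)]) auto
  then have "(B \<longlongrightarrow> B c) (at c within {a..c})" using ac' by (auto simp: continuous_on)
  moreover have "B c < 0"
    using super[OF c(1)] mult_left_mono[OF c(3) \<mu>(2)[OF c(1)]] by (simp add: B_def)
  ultimately have "\<forall>\<^sub>F s in at c within {a..c}. B s < 0" by (rule order_tendstoD(2))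
  then obtain d where d: "d > 0" "\<And>s. s \<in> {a..c} \<Longrightarrow> s \<noteq> c \<Longrightarrow> dist s c < d \<Longrightarrow> B s < 0"
    unfolding eventually_at by blast
  define b where "b = max a (c - d / 2)"
  have b: "a \<le> b" "b < c" using ac' d(1) by (auto simp: b_def)
  have Bneg: "B s < 0" if "s \<in> {b..c}" for s
  proof (cases "s = c")
    case False
    have "a \<le> s" "s \<le> c" "c - d / 2 \<le> s" using that unfolding b_def by auto
    then show ?thesis using False d(1) by (intro d(2)) (auto simp: dist_real_def)
  qed (use \<open>B c < 0\<close> in simp)
  have "V b \<le> Y i b" for i
  proof -
    have "Y i c - V c \<le> Y i b - V b"
    proof (rule abs_cont_on_nonincreasing[OF less_imp_le[OF b(2)] _ N])
      have "(V has_vector_derivative V' s) (at s within {b..c})" if "s \<in> {b..c}" for s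
        by (rule has_vector_derivative_within_subset[OF V(1)[unfolded has_real_derivative_iff_has_vector_derivative]])
          (use that b in auto)
      then have "abs_cont_on b c V"
        by (rule C1_imp_abs_cont_on) (use b in \<open>auto intro!: continuous_on_subset[OF V(2)]\<close>)
      then show "abs_cont_on b c (\<lambda>s. Y i s - V s)"
        by (intro abs_cont_on_diff abs_cont_on_subset[OF ac[OF c(1)] b(1)] order_refl)
    next
      fix s assume s: "s \<in> {b..c} - N"
      then obtain e where e: "(Y i has_real_derivative e) (at s within {a..})" "e \<le> F s - \<mu> s * m s"
        using der[of s i] b unfolding m_def by auto
      have "((\<lambda>s. Y i s - V s) has_real_derivative e - V' s) (at s within {a..})"
        using s b by (intro derivative_intros e V) auto
      then have "((\<lambda>s. Y i s - V s) has_vector_derivative e - V' s) (at s within {b..c})"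
        unfolding has_real_derivative_iff_has_vector_derivative
        by (rule has_vector_derivative_within_subset) (use b in auto)
      moreover have "e - V' s \<le> 0" using e(2) Bneg[of s] s by (auto simp: B_def)
      ultimately show "\<exists>d\<le>0. ((\<lambda>s. Y i s - V s) has_vector_derivative d) (at s within {b..c})" by blast
    qed
    moreover have "m c \<le> Y i c" unfolding m_def by (rule Min_le) auto
    ultimately show ?thesis using c(3) by simp
  qed
  then have "V b \<le> m b" unfolding m_def by simp
  with less[OF b] show False by simp
qed

text \<open>Restriction to the line through \<open>y\<close> and \<open>z\<close> reduces this to
  the tangent inequality for convex functions of one real variable.\<close>

lemma convex_on_gradient_ineq:
  fixes g :: "'a::real_inner \<Rightarrow> real"
  assumes cv: "convex_on UNIV g" and der: "(g has_derivative (\<lambda>h. G \<bullet> h)) (at y)"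
  shows "g y + G \<bullet> (z - y) \<le> g z"
proof -
  define \<phi> where "\<phi> s = g (y + s *\<^sub>R (z - y))" for s :: real
  have "convex_on UNIV \<phi>"
  proof (rule convex_onI)
    fix t u v :: real assume t: "0 < t" "t < 1"
    have "y + ((1 - t) *\<^sub>R u + t *\<^sub>R v) *\<^sub>R (z - y)
        = (1 - t) *\<^sub>R (y + u *\<^sub>R (z - y)) + t *\<^sub>R (y + v *\<^sub>R (z - y))"
      by (simp add: algebra_simps)
    then show "\<phi> ((1 - t) *\<^sub>R u + t *\<^sub>R v) \<le> (1 - t) * \<phi> u + t * \<phi> v"
      unfolding \<phi>_def using convex_onD[OF cv, of t] t by simp
  qed simp
  moreover have "(\<phi> has_field_derivative G \<bullet> (z - y)) (at 0)"
  proof -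
    have "((\<lambda>s. y + s *\<^sub>R (z - y)) has_derivative (\<lambda>s. s *\<^sub>R (z - y))) (at 0)"
      by (auto intro!: derivative_eq_intros)
    moreover have "(g has_derivative (\<lambda>h. G \<bullet> h)) (at (y + 0 *\<^sub>R (z - y)))" using der by simp
    ultimately have "(\<phi> has_derivative (\<lambda>s. G \<bullet> (s *\<^sub>R (z - y)))) (at 0)"
      unfolding \<phi>_def by (rule has_derivative_compose)
    then show ?thesis by (simp add: has_field_derivative_def mult.commute[of _ "G \<bullet> (z - y)"])
  qed
  ultimately have "\<phi> 1 - \<phi> 0 \<ge> G \<bullet> (z - y) * (1 - 0)"
    by (intro convex_on_imp_above_tangent[of UNIV]) auto
  then show ?thesis by (simp add: \<phi>_def)
qed

subsection \<open>Lyapunov analysis\<close>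

lemma has_real_derivative_cmult_powr:
  fixes t :: real
  assumes "t > 0"
  shows "((\<lambda>t. c * t powr s) has_real_derivative c * s * t powr (s - 1)) (at t within A)"
  using DERIV_cmult[OF has_real_derivative_powr[OF assms], THEN has_field_derivative_at_within, of c s A]
  by (simp add: mult.assoc)

lemma has_real_derivative_inner:
  fixes g h :: "real \<Rightarrow> 'a::real_inner"
  assumes "(g has_vector_derivative g') (at t within A)" "(h has_vector_derivative h') (at t within A)"
  shows "((\<lambda>t. g t \<bullet> h t) has_real_derivative g' \<bullet> h t + g t \<bullet> h') (at t within A)"
  using has_derivative_inner[OF assms[unfolded has_vector_derivative_def]]
  unfolding has_field_derivative_def by (rule has_derivative_eq_rhs) (auto simp: algebra_simps)

lemma abs_cont_on_cmult_powr:
  assumes "a > 0"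
  shows "abs_cont_on a b (\<lambda>t. c * t powr s)"
  using assms
  by (intro C1_imp_abs_cont_on[of _ _ _ "\<lambda>t. c * s * t powr (s - 1)"])
    (auto simp: has_real_derivative_iff_has_vector_derivative[symmetric]
      intro!: has_real_derivative_cmult_powr continuous_intros)

section \<open>Trajectories, projection inequalities and energies\<close>

text \<open>Unpacks the existential quantifiers of a solution: \<open>xd\<close> and
  \<open>xdd\<close> are fixed, and one null set \<open>N\<close> serves both for the
  differentiability of \<open>xd\<close> and for the inclusion.\<close>

locale mtrigs_trajectory =
  fixes f :: "'i::finite \<Rightarrow> 'a::{real_inner, complete_space} \<Rightarrow> real"
    and grad :: "'i \<Rightarrow> 'a \<Rightarrow> 'a"
    and t0 \<alpha> \<beta> q p :: real and x xd xdd :: "real \<Rightarrow> 'a" and N :: "real set"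
  assumes conv: "\<And>i. convex_on UNIV (f i)"
    and grad: "\<And>i y. (f i has_derivative (\<lambda>h. grad i y \<bullet> h)) (at y)"
    and cont_grad: "\<And>i. continuous_on UNIV (grad i)"
    and t0: "t0 > 0" and \<alpha>: "\<alpha> > 0" and \<beta>: "\<beta> > 0"
    and q: "0 < q" "q < 1" and p: "0 < p" "p < q + 1"
    and N: "negligible N"
    and x: "\<And>t. t \<ge> t0 \<Longrightarrow> (x has_vector_derivative xd t) (at t within {t0..})"
    and xd: "\<And>t. t \<in> {t0..} - N \<Longrightarrow> (xd has_vector_derivative xdd t) (at t within {t0..})"
    and ac_xd: "\<And>T. T \<ge> t0 \<Longrightarrow> abs_cont_on t0 T xd"
    and incl: "\<And>t. t \<in> {t0..} - N \<Longrightarrow> (\<alpha> / t powr q) *\<^sub>R xd t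
            + proj0 ((\<lambda>c. c + (\<beta> / t powr p) *\<^sub>R x t + xdd t) ` Cset grad (x t)) = 0"
    and bdd: "bounded (x ` {t0..})"
begin

text \<open>With negative exponents, the coefficients here and below are sums of terms
  \<open>c * t powr s\<close>: products add exponents, and a single differentiation rule
  suffices.\<close>

definition damp :: "real \<Rightarrow> real" where "damp t = \<alpha> * t powr (- q)"

definition eps :: "real \<Rightarrow> real" where "eps t = \<beta> * t powr (- p)"

definition W :: "'i \<Rightarrow> real \<Rightarrow> real" where
  "W i t = f i (x t) + eps t / 2 * (x t \<bullet> x t) + 1 / 2 * (xd t \<bullet> xd t)"

text \<open>The inclusion says that \<open>proj0 S = - damp t *\<^sub>R xd t\<close>. The first
  inequality is the variational inequality tested with the \<open>i\<close>-th generator of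
  \<open>S\<close> and divided by \<open>damp t > 0\<close>. For the second, the projection belongs
  to \<open>S\<close>, which yields a second-order equation with some \<open>c\<close> in the convex
  hull of the gradients; convexity bounds \<open>(x t - z) \<bullet> grad j (x t)\<close> below by
  the smallest gap for each \<open>j\<close>, and a half-space bound passes to the hull.\<close>

lemma
  assumes t: "t \<in> {t0..} - N"
  shows energy_dissipation: "xd t \<bullet> (grad i (x t) + eps t *\<^sub>R x t + xdd t) \<le> - damp t * (xd t \<bullet> xd t)"
    and anchor_acceleration: "(x t - z) \<bullet> xdd t \<le> - damp t * ((x t - z) \<bullet> xd t) - (MIN j. f j (x t) - f j z)
      - eps t / 2 * (x t \<bullet> x t - z \<bullet> z) - eps t / 2 * ((x t - z) \<bullet> (x t - z))"
proof -
  have tpos: "t > 0" using t t0 by auto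
  define S where "S = (\<lambda>c. c + eps t *\<^sub>R x t + xdd t) ` Cset grad (x t)"
  have S: "S = (+) (eps t *\<^sub>R x t + xdd t) ` Cset grad (x t)"
    unfolding S_def by (simp add: algebra_simps)
  have "compact (Cset grad (x t))" unfolding Cset_def by (rule finite_imp_compact_convex_hull) simp
  then have "closed S" unfolding S by (intro compact_imp_closed compact_translation)
  have "convex S" unfolding S Cset_def by (intro convex_translation convex_convex_hull)
  have gin: "grad i (x t) + eps t *\<^sub>R x t + xdd t \<in> S" for i
    unfolding S_def Cset_def by (intro imageI hull_inc) auto
  then have "S \<noteq> {}" by auto
  have "damp t > 0" using \<alpha> tpos by (simp add: damp_def)
  have proj: "proj0 S = - damp t *\<^sub>R xd t"
    using incl[OF t] unfolding S_def damp_def eps_def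
    by (simp add: powr_minus divide_inverse add_eq_0_iff)
  show "xd t \<bullet> (grad i (x t) + eps t *\<^sub>R x t + xdd t) \<le> - damp t * (xd t \<bullet> xd t)"
  proof -
    have "0 \<le> - (damp t * (xd t \<bullet> (grad i (x t) + eps t *\<^sub>R x t + xdd t) + damp t * (xd t \<bullet> xd t)))"
      using proj0_inner_ge[OF \<open>closed S\<close> \<open>convex S\<close> gin[of i]]
      unfolding proj by (simp add: inner_diff_right inner_add_right algebra_simps)
    then have "damp t * (xd t \<bullet> (grad i (x t) + eps t *\<^sub>R x t + xdd t) + damp t * (xd t \<bullet> xd t)) \<le> 0"
      by linarith
    then show ?thesis using \<open>damp t > 0\<close> unfolding mult_le_0_iff by linarith
  qed
  have "proj0 S \<in> S" by (rule proj0_min_norm) fact+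
  then obtain c where c: "c \<in> Cset grad (x t)" and "proj0 S = c + eps t *\<^sub>R x t + xdd t"
    unfolding S_def by blast
  then have cS: "- damp t *\<^sub>R xd t = c + eps t *\<^sub>R x t + xdd t" unfolding proj by simp
  define m where "m = (MIN j. f j (x t) - f j z)"
  have "Cset grad (x t) \<subseteq> {c. (x t - z) \<bullet> c \<ge> m}"
    unfolding Cset_def
  proof (rule hull_minimal)
    have "m \<le> (x t - z) \<bullet> grad j (x t)" for j
    proof -
      have "m \<le> f j (x t) - f j z" unfolding m_def by (rule Min_le) auto
      also have "\<dots> \<le> (x t - z) \<bullet> grad j (x t)"
        using convex_on_gradient_ineq[OF conv grad, of j "x t" z] by (simp add: inner_simps inner_commute)
      finally show ?thesis .
    qed
    then show "range (\<lambda>i. grad i (x t)) \<subseteq> {c. m \<le> (x t - z) \<bullet> c}" by auto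
  qed (rule convex_halfspace_ge)
  then have m: "m \<le> (x t - z) \<bullet> c" using c by auto
  have xdd: "xdd t = - damp t *\<^sub>R xd t - c - eps t *\<^sub>R x t" using cS by simp
  have "(x t - z) \<bullet> xdd t = - damp t * ((x t - z) \<bullet> xd t) - (x t - z) \<bullet> c - eps t * ((x t - z) \<bullet> x t)"
    unfolding xdd by (simp add: inner_diff_right)
  \<comment> \<open>This splitting produces the norm difference that appears in the anchored energy
    and, in addition, a quadratic term in \<open>x t - z\<close> that later absorbs the error
    terms.\<close>
  also have "eps t * ((x t - z) \<bullet> x t) = eps t / 2 * (x t \<bullet> x t - z \<bullet> z) + eps t / 2 * ((x t - z) \<bullet> (x t - z))"
    by (simp add: inner_simps algebra_simps inner_commute)
  finally show "(x t - z) \<bullet> xdd t \<le> - damp t * ((x t - z) \<bullet> xd t) - (MIN j. f j (x t) - f j z)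
      - eps t / 2 * (x t \<bullet> x t - z \<bullet> z) - eps t / 2 * ((x t - z) \<bullet> (x t - z))"
    using m unfolding m_def by linarith
qed

lemma eps_pos: "t > 0 \<Longrightarrow> eps t > 0"
  using \<beta> by (simp add: eps_def)

lemma W_has_derivative:
  assumes t: "t \<in> {t0..} - N"
  shows "(W i has_real_derivative (xd t \<bullet> (grad i (x t) + eps t *\<^sub>R x t + xdd t)
      - \<beta> * p * t powr (- p - 1) / 2 * (x t \<bullet> x t))) (at t within {t0..})"
proof -
  have tt: "t \<ge> t0" "t > 0" using t t0 by auto
  have 1: "((\<lambda>t. f i (x t)) has_real_derivative grad i (x t) \<bullet> xd t) (at t within {t0..})"
    using has_derivative_compose[OF x[OF tt(1), unfolded has_vector_derivative_def] grad, of i]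
    by (simp add: has_field_derivative_def mult.commute[of _ "grad i (x t) \<bullet> xd t"])
  have 2: "(eps has_real_derivative \<beta> * (- p) * t powr (- p - 1)) (at t within {t0..})"
    unfolding eps_def by (rule has_real_derivative_cmult_powr[OF tt(2)])
  note 3 = has_real_derivative_inner[OF x[OF tt(1)] x[OF tt(1)]] has_real_derivative_inner[OF xd[OF t] xd[OF t]]
  show ?thesis unfolding W_def
    by (rule DERIV_cong, (rule DERIV_const DERIV_add DERIV_cdivide DERIV_mult 1 2 3)+)
      (simp add: inner_simps inner_commute algebra_simps)
qed

lemma abs_cont_on_x:
  assumes "T \<ge> t0"
  shows "abs_cont_on t0 T x"
  by (rule C1_imp_abs_cont_on[OF _ abs_cont_on_imp_continuous_on[OF ac_xd[OF assms]]])
    (auto intro: has_vector_derivative_within_subset[OF x])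

lemma abs_cont_on_f_x:
  assumes "T \<ge> t0"
  shows "abs_cont_on t0 T (\<lambda>t. f i (x t))"
proof (rule C1_imp_abs_cont_on)
  fix t assume t: "t \<in> {t0..T}"
  then have "((\<lambda>t. f i (x t)) has_vector_derivative grad i (x t) \<bullet> xd t) (at t within {t0..})"
    using has_derivative_compose[OF x[unfolded has_vector_derivative_def] grad, of t i]
    by (simp add: has_vector_derivative_def)
  then show "((\<lambda>t. f i (x t)) has_vector_derivative grad i (x t) \<bullet> xd t) (at t within {t0..T})"
    by (rule has_vector_derivative_within_subset) auto
next
  show "continuous_on {t0..T} (\<lambda>t. grad i (x t) \<bullet> xd t)"
    using assms
    by (intro continuous_intros continuous_on_compose2[OF cont_grad] abs_cont_on_imp_continuous_on
        abs_cont_on_x ac_xd) auto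
qed

lemma abs_cont_on_W:
  assumes "T \<ge> t0"
  shows "abs_cont_on t0 T (W i)"
proof -
  have "abs_cont_on t0 T (\<lambda>t. f i (x t) + (\<beta> / 2 * t powr (- p)) * (x t \<bullet> x t) + 1 / 2 * (xd t \<bullet> xd t))"
    using assms
    by (intro abs_cont_on_add abs_cont_on_mult abs_cont_on_inner abs_cont_on_f_x abs_cont_on_x
        abs_cont_on_cmult_powr abs_cont_on_const t0 ac_xd)
  then show ?thesis unfolding W_def eps_def by simp
qed

text \<open>Both parts of the derivative are nonpositive: the friction term, and the term coming
  from the decrease of \<open>eps\<close>.\<close>

lemma W_antimono:
  assumes "t0 \<le> s" "s \<le> t"
  shows "W i t \<le> W i s"
proof (rule abs_cont_on_nonincreasing[OF assms(2) _ N])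
  show "abs_cont_on s t (W i)"
    using assms by (intro abs_cont_on_subset[OF abs_cont_on_W[of t]]) auto
next
  fix u assume "u \<in> {s..t} - N"
  then have u: "u \<in> {t0..} - N" "u > 0" using assms t0 by auto
  have "damp u * (xd u \<bullet> xd u) \<ge> 0" using \<alpha> u by (simp add: damp_def)
  moreover have "\<beta> * p * u powr (- p - 1) / 2 * (x u \<bullet> x u) \<ge> 0" using \<beta> p by simp
  ultimately have "xd u \<bullet> (grad i (x u) + eps u *\<^sub>R x u + xdd u) - \<beta> * p * u powr (- p - 1) / 2 * (x u \<bullet> x u) \<le> 0"
    using energy_dissipation[OF u(1), of i] by simp
  moreover have "(W i has_vector_derivative (xd u \<bullet> (grad i (x u) + eps u *\<^sub>R x u + xdd u)
      - \<beta> * p * u powr (- p - 1) / 2 * (x u \<bullet> x u))) (at u within {s..t})"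
    using W_has_derivative[OF u(1)] unfolding has_real_derivative_iff_has_vector_derivative
    by (rule has_vector_derivative_within_subset) (use assms in auto)
  ultimately show "\<exists>d\<le>0. (W i has_vector_derivative d) (at u within {s..t})" by blast
qed

end

section \<open>Lyapunov functions anchored at an arbitrary point\<close>

text \<open>\<open>\<kappa>\<close> and \<open>r\<close> fix the decay rate
  \<open>eta t = \<kappa> * t powr (- r)\<close>. The lower bounds on \<open>r\<close> and the
  smallness of \<open>\<kappa>\<close> keep the error terms below friction and regularisation;
  \<open>r < 1\<close> makes the rate strong enough to beat the forcing.\<close>

locale mtrigs_lyapunov = mtrigs_trajectory f grad t0 \<alpha> \<beta> q p x xd xdd N
  for f :: "'i::finite \<Rightarrow> 'a::{real_inner, complete_space} \<Rightarrow> real"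
    and grad t0 \<alpha> \<beta> q p x xd xdd N +
  fixes \<kappa> r :: real
  assumes \<kappa>: "\<kappa> > 0" "2 * \<kappa> \<le> \<alpha>" "\<kappa> * (\<alpha> + r + \<kappa>) \<le> \<beta>"
    and r: "q \<le> r" "p - q \<le> r" "r < 1"
begin

definition eta :: "real \<Rightarrow> real" where "eta t = \<kappa> * t powr (- r)"

text \<open>This is \<open>eta * damp - eta'\<close>, expanded into powers so that it can be
  differentiated term by term.\<close>

definition xi :: "real \<Rightarrow> real" where
  "xi t = \<kappa> * \<alpha> * t powr (- q - r) + r * \<kappa> * t powr (- r - 1)"

text \<open>The part of \<open>lyap\<close> that does not depend on the index, so that it can be
  pulled out of the minimum over \<open>i\<close>. Its last three terms are a square in
  \<open>xd t + eta t *\<^sub>R (x t - z)\<close> plus a multiple of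
  \<open>xi t - (eta t)^2\<close>.\<close>

definition anchor :: "'a \<Rightarrow> real \<Rightarrow> real" where
  "anchor z t = eps t / 2 * (x t \<bullet> x t - z \<bullet> z) + 1 / 2 * (xd t \<bullet> xd t)
     + eta t * ((x t - z) \<bullet> xd t) + xi t / 2 * ((x t - z) \<bullet> (x t - z))"

definition lyap :: "'a \<Rightarrow> 'i \<Rightarrow> real \<Rightarrow> real" where
  "lyap z i t = (f i (x t) - f i z) + anchor z t"

lemma Min_lyap: "(MIN i. lyap z i t) = (MIN i. f i (x t) - f i z) + anchor z t"
  unfolding lyap_def by (rule Min_add_commute) auto

text \<open>For \<open>t \<ge> 1\<close> powers are compared through their exponents:
  \<open>r \<ge> q\<close> gives the bound by \<open>damp\<close>, while \<open>q + r\<close>,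
  \<open>r + 1\<close> and \<open>2 * r\<close> are all at least \<open>p\<close>, so that every
  term of \<open>xi\<close> and \<open>eta^2\<close> is dominated by \<open>t powr (- p)\<close> and
  the condition on \<open>\<kappa>\<close> handles the constants.\<close>

lemma
  assumes t: "t \<ge> 1"
  shows eta_pos: "eta t > 0"
    and eta_le_damp: "2 * eta t \<le> damp t"
    and xi_le_eps: "xi t + (eta t)\<^sup>2 \<le> eps t"
    and eta_le_xi: "(eta t)\<^sup>2 \<le> xi t"
proof -
  have r0: "r > 0" using r q by simp
  show eta: "eta t > 0" using \<kappa> t by (simp add: eta_def)
  have "2 * \<kappa> * t powr (- r) \<le> \<alpha> * t powr (- q)"
    using t r \<kappa> by (intro mult_mono powr_mono) auto
  then show le: "2 * eta t \<le> damp t" by (simp add: eta_def damp_def)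
  have sq: "(eta t)\<^sup>2 = \<kappa> * \<kappa> * t powr (- 2 * r)"
    using t by (simp add: eta_def power2_eq_square powr_add[symmetric] mult_ac)
  have "xi t + (eta t)\<^sup>2 \<le> \<kappa> * \<alpha> * t powr (- p) + r * \<kappa> * t powr (- p) + \<kappa> * \<kappa> * t powr (- p)"
    unfolding sq xi_def using t r q p \<kappa> \<alpha> r0 by (intro add_mono mult_left_mono powr_mono) auto
  also have "\<dots> = \<kappa> * (\<alpha> + r + \<kappa>) * t powr (- p)" by (simp add: algebra_simps)
  also have "\<dots> \<le> eps t" unfolding eps_def using \<kappa> by (intro mult_right_mono) auto
  finally show "xi t + (eta t)\<^sup>2 \<le> eps t" .
  have "(eta t)\<^sup>2 \<le> eta t * damp t"
    unfolding power2_eq_square using eta le by (intro mult_left_mono) auto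
  also have "\<dots> = \<kappa> * \<alpha> * t powr (- q - r)"
    using t by (simp add: eta_def damp_def powr_add[symmetric] mult_ac)
  also have "\<dots> \<le> xi t" using r0 \<kappa> by (simp add: xi_def)
  finally show "(eta t)\<^sup>2 \<le> xi t" .
qed

text \<open>The choice \<open>xi = eta * damp - eta'\<close> cancels the terms in \<open>(x - z) \<bullet> xd\<close>, and the rate \<open>eta\<close>
  makes the gap term cancel exactly, so no sign of the gap at an arbitrary anchor is needed.\<close>
lemma lyap_derivative:
  assumes t: "t \<in> {t0..} - N" "t \<ge> 1"
  shows "\<exists>d. (lyap z i has_real_derivative d) (at t within {t0..}) \<and>
    d \<le> \<beta> * p / 2 * (z \<bullet> z) * t powr (- p - 1) - eta t * (MIN j. lyap z j t)"
proof -
  have tt: "t \<ge> t0" "t > 0" using t t0 by auto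
  define P where "P = (x t - z) \<bullet> xd t"
  define Q where "Q = (x t - z) \<bullet> (x t - z)"
  define D where "D = xd t \<bullet> xd t"
  define X where "X = x t \<bullet> x t"
  define M where "M = (MIN j. f j (x t) - f j z)"
  define w where "w = xd t \<bullet> (grad i (x t) + eps t *\<^sub>R x t + xdd t)"
  define e' where "e' = \<beta> * p * t powr (- p - 1)"
  define eta' where "eta' = \<kappa> * (- r) * t powr (- r - 1)"
  define xi' where "xi' = \<kappa> * \<alpha> * (- q - r) * t powr (- q - r - 1) + r * \<kappa> * (- r - 1) * t powr (- r - 1 - 1)"
  have xz: "((\<lambda>t. x t - z) has_vector_derivative xd t) (at t within {t0..})"
    using has_vector_derivative_diff[OF x[OF tt(1)] has_vector_derivative_const[of z]] by simp
  have de: "(eps has_real_derivative \<beta> * (- p) * t powr (- p - 1)) (at t within {t0..})"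
    unfolding eps_def by (rule has_real_derivative_cmult_powr[OF tt(2)])
  have deta: "(eta has_real_derivative eta') (at t within {t0..})"
    unfolding eta_def eta'_def by (rule has_real_derivative_cmult_powr[OF tt(2)])
  have dxi: "(xi has_real_derivative xi') (at t within {t0..})"
    unfolding xi_def xi'_def by (intro derivative_intros has_real_derivative_cmult_powr tt(2))
  \<comment> \<open>Rewriting through \<open>W\<close> lets the dissipation already computed for the
    energies be reused.\<close>
  have lyap: "lyap z i = (\<lambda>t. W i t - f i z - eps t / 2 * (z \<bullet> z)
      + eta t * ((x t - z) \<bullet> xd t) + xi t / 2 * ((x t - z) \<bullet> (x t - z)))"
    by (rule ext) (simp add: lyap_def W_def anchor_def algebra_simps)
  note ds = has_real_derivative_inner[OF xz xd[OF t(1)]] has_real_derivative_inner[OF xz xz] W_has_derivative[OF t(1)]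
  let ?d = "(w - e' / 2 * X) + e' / 2 * (z \<bullet> z)
      + (eta' * P + eta t * (D + (x t - z) \<bullet> xdd t)) + (xi' / 2 * Q + xi t * P)"
  have "(lyap z i has_real_derivative ?d) (at t within {t0..})"
    unfolding lyap
    by (rule DERIV_cong, (rule DERIV_const DERIV_add DERIV_diff DERIV_cdivide DERIV_mult de deta dxi ds)+)
      (simp add: P_def Q_def D_def X_def w_def e'_def inner_commute[of "xd t" "x t"] inner_commute[of "xd t" z]
          inner_diff_left inner_diff_right algebra_simps)
  moreover have "?d \<le> \<beta> * p / 2 * (z \<bullet> z) * t powr (- p - 1) - eta t * (MIN j. lyap z j t)"
  proof -
    have eta: "eta t > 0" using t by (intro eta_pos)
    have "eta' = - r * \<kappa> * t powr (- r - 1)" by (simp add: eta'_def)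
    moreover have "eta t * damp t = \<kappa> * \<alpha> * t powr (- q - r)"
      using tt by (simp add: eta_def damp_def powr_add[symmetric] mult_ac)
    ultimately have xi: "xi t = eta t * damp t - eta'" by (simp add: xi_def)
    \<comment> \<open>\<open>xi\<close> is a sum of decaying powers with positive coefficients, so
      its derivative may be dropped from the upper bound.\<close>
    have "xi' \<le> 0"
      unfolding xi'_def using \<kappa> \<alpha> q r by (intro add_nonpos_nonpos mult_nonpos_nonneg mult_nonneg_nonpos) auto
    then have 1: "xi' / 2 * Q \<le> 0" by (simp add: Q_def mult_nonpos_nonneg)
    have 2: "w \<le> - damp t * D" unfolding w_def D_def by (rule energy_dissipation[OF t(1)])
    have 3: "- (e' / 2 * X) \<le> 0" using \<beta> p by (simp add: e'_def X_def)
    have 4: "eta t * ((x t - z) \<bullet> xdd t) \<le> eta t * (- damp t * P - M - eps t / 2 * (X - z \<bullet> z) - eps t / 2 * Q)"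
      using anchor_acceleration[OF t(1), of z] eta
      unfolding P_def Q_def M_def X_def by (intro mult_left_mono) auto
    have "0 \<le> (xd t - eta t *\<^sub>R (x t - z)) \<bullet> (xd t - eta t *\<^sub>R (x t - z))" by simp
    also have "\<dots> = D - 2 * eta t * P + (eta t)\<^sup>2 * Q"
      by (simp add: D_def P_def Q_def inner_diff_left inner_diff_right inner_commute power2_eq_square algebra_simps)
    finally have "eta t * (2 * eta t * P) \<le> eta t * (D + (eta t)\<^sup>2 * Q)"
      using eta by (intro mult_left_mono) auto
    moreover have "0 \<le> (damp t - 2 * eta t) * D" using eta_le_damp[of t] t by (simp add: D_def)
    moreover have "0 \<le> eta t / 2 * (eps t - xi t - (eta t)\<^sup>2) * Q"
      using eta xi_le_eps[of t] t by (auto simp: Q_def intro!: mult_nonneg_nonneg)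
    \<comment> \<open>Balance of the error terms. The factor \<open>3 / 2\<close> collects
      \<open>eta * D\<close> from differentiating the cross term and half of it from the kinetic
      part of \<open>eta * lyap\<close>; Young's inequality for \<open>P\<close> adds another half,
      and \<open>2 * eta \<le> damp\<close> pays for the total. The terms in \<open>Q\<close> are
      paid for by \<open>xi + eta^2 \<le> eps\<close>.\<close>
    ultimately have 5: "eta t * (eta t * P) + eta t * (3 / 2 * D) + eta t * (xi t / 2 * Q) - eta t * (eps t / 2 * Q) \<le> damp t * D"
      by (simp add: algebra_simps power2_eq_square)
    have "?d \<le> - damp t * D + e' / 2 * (z \<bullet> z) + (eta' * P + eta t * D
        + eta t * (- damp t * P - M - eps t / 2 * (X - z \<bullet> z) - eps t / 2 * Q)) + xi t * P"
      using 1 2 3 4 by (simp add: distrib_left)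
    also have "\<dots> = - damp t * D + e' / 2 * (z \<bullet> z) + eta t * D
        + eta t * (- M - eps t / 2 * (X - z \<bullet> z) - eps t / 2 * Q)"
      unfolding xi by (simp add: algebra_simps)
    also have "\<dots> \<le> e' / 2 * (z \<bullet> z) - eta t * (M + (eps t / 2 * (X - z \<bullet> z) + 1 / 2 * D + eta t * P + xi t / 2 * Q))"
      using 5 by (simp add: algebra_simps)
    also have "M + (eps t / 2 * (X - z \<bullet> z) + 1 / 2 * D + eta t * P + xi t / 2 * Q) = (MIN j. lyap z j t)"
      unfolding Min_lyap anchor_def M_def X_def D_def P_def Q_def by simp
    finally show ?thesis by (simp add: e'_def mult_ac)
  qed
  ultimately show ?thesis by blast
qed

lemma abs_cont_on_lyap:
  assumes "T \<ge> t0"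
  shows "abs_cont_on t0 T (lyap z i)"
proof -
  have "abs_cont_on t0 T (\<lambda>t. (f i (x t) - f i z) + ((\<beta> / 2 * t powr (- p)) * (x t \<bullet> x t - z \<bullet> z) + 1 / 2 * (xd t \<bullet> xd t)
     + (\<kappa> * t powr (- r)) * ((x t - z) \<bullet> xd t)
     + (\<kappa> * \<alpha> / 2 * t powr (- q - r) + r * \<kappa> / 2 * t powr (- r - 1)) * ((x t - z) \<bullet> (x t - z))))"
    using assms
    by (intro abs_cont_on_add abs_cont_on_diff abs_cont_on_mult abs_cont_on_inner abs_cont_on_f_x abs_cont_on_x
        abs_cont_on_cmult_powr abs_cont_on_const t0 ac_xd)
  then show ?thesis
    unfolding lyap_def anchor_def eps_def eta_def xi_def by (simp add: add_divide_distrib)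
qed

text \<open>\<open>B\<close> depends on \<open>t\<close> and \<open>R\<close> but not on the anchor;
  at the starting time of the comparison it provides initial data valid for all anchors in the ball
  at once. The tangent plane at the origin bounds \<open>f i z\<close> from below, and
  Cauchy-Schwarz handles the remaining terms.\<close>

lemma lyap_uniform_bound:
  "\<exists>B. \<forall>z. norm z \<le> R \<longrightarrow> (MIN i. lyap z i t) \<le> B"
proof (intro exI allI impI)
  fix z :: 'a assume z: "norm z \<le> R"
  \<comment> \<open>Any single index bounds the minimum from above; \<open>undefined\<close> serves
    as an arbitrary one.\<close>
  show "(MIN i. lyap z i t) \<le> (f undefined (x t) - f undefined 0 + norm (grad undefined 0) * R)
    + (\<bar>eps t / 2\<bar> * (x t \<bullet> x t + R * R) + 1 / 2 * (xd t \<bullet> xd t)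
     + \<bar>eta t\<bar> * ((norm (x t) + R) * norm (xd t)) + \<bar>xi t / 2\<bar> * ((norm (x t) + R) * (norm (x t) + R)))"
    (is "_ \<le> ?F + ?G")
  proof -
    have nz: "norm (x t - z) \<le> norm (x t) + R" using norm_triangle_ineq4[of "x t" z] z by simp
    have R: "R \<ge> 0" using z norm_ge_zero order_trans by blast
    have "(MIN i. lyap z i t) \<le> lyap z undefined t" by (rule Min_le) auto
    moreover have "f undefined (x t) - f undefined z \<le> ?F"
    proof -
      have "- (grad undefined 0 \<bullet> z) \<le> norm (grad undefined 0) * norm z"
        using Cauchy_Schwarz_ineq2[of "grad undefined 0" z] by linarith
      also have "\<dots> \<le> norm (grad undefined 0) * R" using z by (simp add: mult_left_mono)
      finally show ?thesis using convex_on_gradient_ineq[OF conv grad, of undefined 0 z] by simp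
    qed
    moreover have "anchor z t \<le> ?G"
      unfolding anchor_def
    proof (intro add_mono order_refl)
      have mult: "a * b \<le> \<bar>a\<bar> * c" if "\<bar>b\<bar> \<le> c" for a b c :: real
        using abs_ge_self[of "a * b"] mult_left_mono[OF that abs_ge_zero[of a]] by (simp add: abs_mult)
      have "z \<bullet> z \<le> R * R" using z R unfolding dot_square_norm power2_eq_square by (intro mult_mono) auto
      then have "\<bar>x t \<bullet> x t - z \<bullet> z\<bar> \<le> x t \<bullet> x t + R * R"
        using inner_ge_zero[of "x t"] inner_ge_zero[of z] by linarith
      then show "eps t / 2 * (x t \<bullet> x t - z \<bullet> z) \<le> \<bar>eps t / 2\<bar> * (x t \<bullet> x t + R * R)" by (rule mult)
      have "\<bar>(x t - z) \<bullet> xd t\<bar> \<le> (norm (x t) + R) * norm (xd t)"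
        by (rule order_trans[OF Cauchy_Schwarz_ineq2]) (use nz in \<open>simp add: mult_right_mono\<close>)
      then show "eta t * ((x t - z) \<bullet> xd t) \<le> \<bar>eta t\<bar> * ((norm (x t) + R) * norm (xd t))" by (rule mult)
      have "\<bar>(x t - z) \<bullet> (x t - z)\<bar> \<le> (norm (x t) + R) * (norm (x t) + R)"
        by (rule order_trans[OF Cauchy_Schwarz_ineq2]) (use nz R in \<open>intro mult_mono; simp\<close>)
      then show "xi t / 2 * ((x t - z) \<bullet> (x t - z)) \<le> \<bar>xi t / 2\<bar> * ((norm (x t) + R) * (norm (x t) + R))" by (rule mult)
    qed
    ultimately show ?thesis unfolding lyap_def by linarith
  qed
qed

end

section \<open>Decay uniform in the anchor\<close>

context mtrigs_lyapunov
begin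

text \<open>\<open>A * t powr (- p - \<delta>)\<close> is a strict supersolution of the differential
  inequality for the minimum, with \<open>\<delta>\<close>, \<open>T\<close> and \<open>A\<close>
  independent of the anchor. The extra \<open>\<delta>\<close> in the exponent is what makes the
  bound negligible against \<open>eps\<close>.\<close>

lemma Min_lyap_decay:
  "\<exists>A \<delta> T. \<delta> > 0 \<and> T \<ge> t0 \<and> T \<ge> 1 \<and>
    (\<forall>z. norm z \<le> R \<longrightarrow> (\<forall>t\<ge>T. (MIN i. lyap z i t) < A * t powr (- p - \<delta>)))"
proof -
  \<comment> \<open>With this choice \<open>eta * V\<close> is of order
    \<open>t powr (- p - 1 + \<delta>)\<close>, which dominates the forcing, of order
    \<open>t powr (- p - 1)\<close>, and also \<open>V'\<close>, of order
    \<open>t powr (- p - 1 - \<delta>)\<close>.\<close>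
  define \<delta> where "\<delta> = (1 - r) / 2"
  have \<delta>: "\<delta> > 0" using r by (simp add: \<delta>_def)
  \<comment> \<open>From \<open>T\<close> on, \<open>\<kappa> * t powr \<delta>\<close> exceeds the
    contribution \<open>p + \<delta>\<close> of \<open>V'\<close> by at least 1.\<close>
  define T where "T = max (max t0 1) (((p + \<delta> + 1) / \<kappa>) powr (1 / \<delta>))"
  have T: "T \<ge> t0" "T \<ge> 1" by (simp_all add: T_def)
  have "(p + \<delta> + 1) / \<kappa> = (((p + \<delta> + 1) / \<kappa>) powr (1 / \<delta>)) powr \<delta>"
    using p \<delta> \<kappa> by (simp add: powr_powr)
  also have "\<dots> \<le> T powr \<delta>" using \<delta> by (intro powr_mono2) (auto simp: T_def)
  finally have T\<delta>: "p + \<delta> + 1 \<le> \<kappa> * T powr \<delta>" using \<kappa> by (simp add: field_simps)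
  obtain B where B: "\<And>z. norm z \<le> R \<Longrightarrow> (MIN i. lyap z i T) \<le> B"
    using lyap_uniform_bound by blast
  define K where "K = \<beta> * p / 2 * R\<^sup>2"
  have K: "K \<ge> 0" using \<beta> p by (simp add: K_def)
  \<comment> \<open>\<open>K + 1\<close> beats the forcing; the other summand puts
    \<open>V T\<close> above the initial bound \<open>B\<close>.\<close>
  define A where "A = K + 1 + (\<bar>B\<bar> + 1) * T powr (p + \<delta>)"
  have "0 \<le> (\<bar>B\<bar> + 1) * T powr (p + \<delta>)" by (intro mult_nonneg_nonneg) auto
  then have A: "A > K" unfolding A_def by linarith
  define V where "V t = A * t powr (- p - \<delta>)" for t
  define V' where "V' t = A * (- p - \<delta>) * t powr (- p - \<delta> - 1)" for t
  have "(MIN i. lyap z i t) < V t" if z: "norm z \<le> R" and t: "t \<ge> T" for z t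
  proof (rule Min_less_supersolution[where Y = "lyap z" and \<mu> = eta and V' = V'
        and F = "\<lambda>t. \<beta> * p / 2 * (z \<bullet> z) * t powr (- p - 1)", OF _ N _ _ _ _ _ _ _ _ t])
    show "abs_cont_on T S (lyap z i)" if "S \<ge> T" for i S
      using that T by (intro abs_cont_on_subset[OF abs_cont_on_lyap[of S]]) auto
    show "\<exists>d. (lyap z i has_real_derivative d) (at s within {T..}) \<and>
        d \<le> \<beta> * p / 2 * (z \<bullet> z) * s powr (- p - 1) - eta s * (MIN j. lyap z j s)" if "s \<in> {T..} - N" for i s
    proof -
      have "s \<in> {t0..} - N" "s \<ge> 1" using that T by auto
      from lyap_derivative[OF this, of z i] show ?thesis
        using T by (blast intro: DERIV_subset)
    qed
    have pos: "s > 0" "s \<ge> 1" if "s \<ge> T" for s using that T by auto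
    show "continuous_on {T..} (\<lambda>t. \<beta> * p / 2 * (z \<bullet> z) * t powr (- p - 1))" "continuous_on {T..} eta"
      "continuous_on {T..} V'"
      unfolding eta_def V'_def using pos by (auto intro!: continuous_intros)
    show "eta s \<ge> 0" if "s \<ge> T" for s using eta_pos[OF pos(2)[OF that]] by simp
    show "(V has_real_derivative V' s) (at s within {T..})" if "s \<ge> T" for s
      unfolding V_def V'_def by (rule has_real_derivative_cmult_powr[OF pos(1)[OF that]])
    show "\<beta> * p / 2 * (z \<bullet> z) * s powr (- p - 1) - eta s * V s < V' s" if s: "s \<ge> T" for s
    proof -
      note pos = pos[OF s]
      have "s powr (- \<delta>) \<le> 1" using powr_mono[of "- \<delta>" 0 s] pos \<delta> by simp
      then have "(p + \<delta>) * s powr (- \<delta>) \<le> (p + \<delta>) * 1" using p \<delta> by (intro mult_left_mono) auto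
      moreover have "\<kappa> * T powr \<delta> \<le> \<kappa> * s powr \<delta>" using s T \<delta> \<kappa> by (intro mult_left_mono powr_mono2) auto
      ultimately have "1 \<le> \<kappa> * s powr \<delta> - (p + \<delta>) * s powr (- \<delta>)" using T\<delta> by simp
      then have "A * 1 \<le> A * (\<kappa> * s powr \<delta> - (p + \<delta>) * s powr (- \<delta>))"
        using A K by (intro mult_left_mono) auto
      then have "K < A * (\<kappa> * s powr \<delta> - (p + \<delta>) * s powr (- \<delta>))" using A by linarith
      then have "s powr (- p - 1) * K < s powr (- p - 1) * (A * (\<kappa> * s powr \<delta> - (p + \<delta>) * s powr (- \<delta>)))"
        using pos by (intro mult_strict_left_mono) auto
      also have "\<dots> = A * \<kappa> * (s powr (- p - 1) * s powr \<delta>) - A * (p + \<delta>) * (s powr (- p - 1) * s powr (- \<delta>))"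
        unfolding right_diff_distrib by (simp only: mult_ac)
      also have "s powr (- p - 1) * s powr \<delta> = s powr (- r) * s powr (- p - \<delta>)"
      proof -
        have "- p - 1 + \<delta> = - r + (- p - \<delta>)" unfolding \<delta>_def by (simp add: field_simps)
        then show ?thesis by (simp only: powr_add[symmetric])
      qed
      also have "s powr (- p - 1) * s powr (- \<delta>) = s powr (- p - \<delta> - 1)"
      proof -
        have "- p - 1 + - \<delta> = - p - \<delta> - 1" by simp
        then show ?thesis by (simp only: powr_add[symmetric])
      qed
      finally have "K * s powr (- p - 1) < eta s * V s + V' s"
        unfolding eta_def V_def V'_def by argo
      moreover have "\<beta> * p / 2 * (z \<bullet> z) * s powr (- p - 1) \<le> K * s powr (- p - 1)"
        unfolding K_def dot_square_norm using z \<beta> p by (intro mult_right_mono mult_left_mono power_mono) auto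
      ultimately show ?thesis by linarith
    qed
    have "(\<bar>B\<bar> + 1) = (\<bar>B\<bar> + 1) * T powr (p + \<delta>) * T powr (- p - \<delta>)"
      using T by (simp add: powr_add[symmetric])
    also have "\<dots> \<le> V T" unfolding V_def A_def using K by (intro mult_right_mono) auto
    finally show "(MIN j. lyap z j T) < V T" using B[OF z] by linarith
  qed
  then show ?thesis using \<delta> T unfolding V_def by blast
qed

text \<open>Completing the square: kinetic, cross and \<open>xi\<close> terms together are
  nonnegative because \<open>eta^2 \<le> xi\<close>.\<close>

lemma anchored_gap_le_lyap:
  assumes "t \<ge> 1"
  shows "(MIN i. f i (x t) - f i z) + eps t / 2 * (x t \<bullet> x t - z \<bullet> z) \<le> (MIN i. lyap z i t)"
proof -
  have "0 \<le> (xd t + eta t *\<^sub>R (x t - z)) \<bullet> (xd t + eta t *\<^sub>R (x t - z))" by simp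
  also have "\<dots> = xd t \<bullet> xd t + 2 * eta t * ((x t - z) \<bullet> xd t) + (eta t)\<^sup>2 * ((x t - z) \<bullet> (x t - z))"
    by (simp add: inner_add_left inner_add_right inner_commute[of "xd t" "x t - z"] power2_eq_square distrib_left mult.assoc)
  also have "\<dots> \<le> xd t \<bullet> xd t + 2 * eta t * ((x t - z) \<bullet> xd t) + xi t * ((x t - z) \<bullet> (x t - z))"
    using eta_le_xi[OF assms] by (simp add: mult_right_mono)
  finally show ?thesis unfolding Min_lyap anchor_def by simp
qed

text \<open>At the anchor \<open>x t\<close> every other term vanishes. The anchor varies with
  \<open>t\<close>, which is allowed because the decay bound holds at each time for all anchors in a
  ball.\<close>

lemma kinetic_eq_lyap: "1 / 2 * (xd t \<bullet> xd t) = (MIN i. lyap (x t) i t)"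
  unfolding Min_lyap anchor_def by simp

end

section \<open>Elimination of the auxiliary constants\<close>

context mtrigs_trajectory
begin

lemma anchored_gap_decay:
  "\<exists>A \<delta> T. \<delta> > 0 \<and> T \<ge> t0 \<and> (\<forall>t\<ge>T.
    (\<forall>z. norm z \<le> R \<longrightarrow> (MIN i. f i (x t) - f i z) + eps t / 2 * (x t \<bullet> x t - z \<bullet> z) < A * t powr (- p - \<delta>)) \<and>
    (norm (x t) \<le> R \<longrightarrow> 1 / 2 * (xd t \<bullet> xd t) < A * t powr (- p - \<delta>)))"
proof -
  \<comment> \<open>The smallest admissible exponent; it is below 1 exactly because
    \<open>q < 1\<close> and \<open>p < q + 1\<close>.\<close>
  define r where "r = max q (p - q)"
  \<comment> \<open>The cap 1 replaces \<open>\<alpha> + r + \<kappa>\<close> by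
    \<open>\<alpha> + r + 1\<close>, so that the quadratic condition on \<open>\<kappa>\<close>
    becomes a linear one.\<close>
  define \<kappa> where "\<kappa> = min 1 (min (\<alpha> / 2) (\<beta> / (\<alpha> + r + 1)))"
  have r: "q \<le> r" "p - q \<le> r" "r < 1" using p q by (auto simp: r_def)
  then have "r > 0" using q by simp
  then have \<kappa>: "\<kappa> > 0" "2 * \<kappa> \<le> \<alpha>" "\<kappa> \<le> 1" "\<kappa> \<le> \<beta> / (\<alpha> + r + 1)"
    using \<alpha> \<beta> by (auto simp: \<kappa>_def)
  have "\<kappa> * (\<alpha> + r + \<kappa>) \<le> \<kappa> * (\<alpha> + r + 1)" using \<kappa> by (intro mult_left_mono) auto
  also have "\<dots> \<le> \<beta>" using \<kappa> \<alpha> \<open>r > 0\<close> by (simp add: field_simps)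
  finally interpret mtrigs_lyapunov f grad t0 \<alpha> \<beta> q p x xd xdd N \<kappa> r
    using r \<kappa> by unfold_locales auto
  obtain A \<delta> T where *: "\<delta> > 0" "T \<ge> t0" "T \<ge> 1"
    "\<And>z t. norm z \<le> R \<Longrightarrow> t \<ge> T \<Longrightarrow> (MIN i. lyap z i t) < A * t powr (- p - \<delta>)"
    using Min_lyap_decay[of R] by blast
  show ?thesis
  proof (rule exI[of _ A], rule exI[of _ \<delta>], rule exI[of _ T], intro conjI allI impI)
    fix t and z :: 'a assume "T \<le> t" "norm z \<le> R"
    then show "(MIN i. f i (x t) - f i z) + eps t / 2 * (x t \<bullet> x t - z \<bullet> z) < A * t powr (- p - \<delta>)"
      using *(3) by (intro order.strict_trans1[OF anchored_gap_le_lyap *(4)]) auto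
  next
    fix t assume "T \<le> t" "norm (x t) \<le> R"
    then show "1 / 2 * (xd t \<bullet> xd t) < A * t powr (- p - \<delta>)"
      unfolding kinetic_eq_lyap by (intro *)
  qed (use * in auto)
qed

end

subsection \<open>Convergence\<close>

lemma antimono_bounded_below_tendsto_at_top:
  fixes g :: "real \<Rightarrow> real"
  assumes mono: "\<And>s t. a \<le> s \<Longrightarrow> s \<le> t \<Longrightarrow> g t \<le> g s" and B: "\<And>t. a \<le> t \<Longrightarrow> B \<le> g t"
  shows "\<exists>l. (g \<longlongrightarrow> l) at_top"
proof -
  define l where "l = (INF t\<in>{a..}. g t)"
  have bdd: "bdd_below (g ` {a..})" by (rule bdd_belowI2[of _ B]) (use B in simp)
  have "(g \<longlongrightarrow> l) at_top"
  proof (rule order_tendstoI)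
    fix c assume "c < l"
    then show "\<forall>\<^sub>F t in at_top. c < g t"
      using cINF_lower[OF bdd] unfolding l_def
      by (intro eventually_mono[OF eventually_ge_at_top[of a]]) (force intro: less_le_trans)
  next
    fix c assume "l < c"
    then obtain s where s: "s \<ge> a" "g s < c" unfolding l_def using cINF_less_iff[OF _ bdd, of c] by auto
    show "\<forall>\<^sub>F t in at_top. g t < c"
      using eventually_ge_at_top[of s] by eventually_elim (use s mono[of s] in \<open>force intro: le_less_trans\<close>)
  qed
  then show ?thesis by blast
qed

lemma cmult_neg_powr_tendsto_0:
  fixes s :: real
  assumes "s < 0"
  shows "((\<lambda>t. c * t powr s) \<longlongrightarrow> 0) at_top"
  using tendsto_mult_right_zero[OF tendsto_neg_powr[OF assms filterlim_ident]] .

lemma convex_sublevel: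
  assumes "convex_on UNIV g"
  shows "convex {y. g y \<le> (c::real)}"
proof (rule convexI)
  fix y z u v assume *: "y \<in> {y. g y \<le> c}" "z \<in> {y. g y \<le> c}" "0 \<le> u" "0 \<le> v" "u + v = (1::real)"
  then have "g (u *\<^sub>R y + v *\<^sub>R z) \<le> u * g y + v * g z"
    using assms unfolding convex_on_def by auto
  also have "\<dots> \<le> u * c + v * c" using * by (intro add_mono mult_left_mono) auto
  also have "\<dots> = c" using *(5) by (simp flip: distrib_right)
  finally show "u *\<^sub>R y + v *\<^sub>R z \<in> {y. g y \<le> c}" by simp
qed

lemma closed_convex_sublevels:
  assumes "\<And>i. convex_on UNIV (f i)" "\<And>i. continuous_on UNIV (f i)"
  shows "closed {y. \<forall>i. f i y \<le> (b i::real)}" "convex {y. \<forall>i. f i y \<le> b i}"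
proof -
  have *: "{y. \<forall>i. f i y \<le> b i} = (\<Inter>i. {y. f i y \<le> b i})" by auto
  show "closed {y. \<forall>i. f i y \<le> (b i::real)}"
    unfolding * using assms by (intro closed_INT ballI closed_Collect_le) auto
  show "convex {y. \<forall>i. f i y \<le> b i}"
    unfolding * using assms by (intro convex_INT convex_sublevel) auto
qed

text \<open>All minimisers share the same maximal value, so the argmin is a joint sublevel set of
  the \<open>f i\<close>. For continuous convex \<open>f i\<close> it is thus closed and convex, and
  \<open>proj0\<close> applies to it.\<close>

lemma Sw_eq_sublevel:
  assumes "y \<in> Sw f w"
  shows "Sw f w = {z. \<forall>i. f i z \<le> w $ i + Max (range (\<lambda>i. f i y - w $ i))}"
proof -
  have "z \<in> Sw f w \<longleftrightarrow> Max (range (\<lambda>i. f i z - w $ i)) \<le> Max (range (\<lambda>i. f i y - w $ i))" for z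
    using assms unfolding Sw_def by (auto intro: order_trans)
  then show ?thesis by (auto simp: algebra_simps)
qed

section \<open>Limit of the values, then of the trajectory\<close>

context mtrigs_trajectory
begin

lemma continuous_f: "continuous_on S (f i)"
  using has_derivative_continuous[OF grad] by (auto intro: continuous_at_imp_continuous_on)

lemma proj0_Sw:
  assumes "Sw f w \<noteq> {}"
  shows "proj0 (Sw f w) \<in> Sw f w" "\<And>y. y \<in> Sw f w \<Longrightarrow> norm (proj0 (Sw f w)) \<le> norm y"
proof -
  obtain y where "y \<in> Sw f w" using assms by auto
  note eq = Sw_eq_sublevel[OF this]
  have "closed (Sw f w)" "convex (Sw f w)"
    by (subst eq, rule closed_convex_sublevels[OF conv continuous_f])+
  then show "proj0 (Sw f w) \<in> Sw f w" "\<And>y. y \<in> Sw f w \<Longrightarrow> norm (proj0 (Sw f w)) \<le> norm y"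
    using proj0_min_norm assms by blast+
qed

lemma eps_tendsto_0: "(eps \<longlongrightarrow> 0) at_top"
  unfolding eps_def using p by (intro cmult_neg_powr_tendsto_0) simp

lemma eps_times_bounded_tendsto_0:
  assumes "\<forall>\<^sub>F t in at_top. norm (y t :: 'a) \<le> R"
  shows "((\<lambda>t. eps t / 2 * (y t \<bullet> y t)) \<longlongrightarrow> 0) at_top"
proof (rule tendsto_sandwich[of "\<lambda>_. 0" _ _ "\<lambda>t. eps t / 2 * R\<^sup>2"])
  show "\<forall>\<^sub>F t in at_top. 0 \<le> eps t / 2 * (y t \<bullet> y t)"
    using eventually_gt_at_top[of 0] by eventually_elim (simp add: less_imp_le[OF eps_pos])
  show "\<forall>\<^sub>F t in at_top. eps t / 2 * (y t \<bullet> y t) \<le> eps t / 2 * R\<^sup>2"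
    using assms eventually_gt_at_top[of 0]
    by eventually_elim (auto simp: dot_square_norm less_imp_le[OF eps_pos] intro!: mult_left_mono power_mono)
  show "((\<lambda>t. eps t / 2 * R\<^sup>2) \<longlongrightarrow> 0) at_top"
    using eps_tendsto_0 by (auto intro!: tendsto_eq_intros)
qed auto

text \<open>Each energy \<open>W i\<close> is nonincreasing and bounded below, hence convergent. Its
  kinetic part vanishes by the decay estimate at the anchor \<open>x t\<close>, and its regularising
  part because the trajectory is bounded; what is left is the value.\<close>

lemma f_tendsto: "\<exists>w. \<forall>i. ((\<lambda>t. f i (x t)) \<longlongrightarrow> w i) at_top"
proof -
  obtain R where R: "\<And>t. t \<ge> t0 \<Longrightarrow> norm (x t) \<le> R" "R \<ge> 0"
    using bdd unfolding bounded_pos by (metis atLeast_iff imageI less_imp_le)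
  obtain A \<delta> T where A: "\<delta> > 0" "T \<ge> t0" "\<And>t. t \<ge> T \<Longrightarrow> norm (x t) \<le> R \<Longrightarrow> 1 / 2 * (xd t \<bullet> xd t) < A * t powr (- p - \<delta>)"
    using anchored_gap_decay[of R] by blast
  have kin: "((\<lambda>t. 1 / 2 * (xd t \<bullet> xd t)) \<longlongrightarrow> 0) at_top"
  proof (rule tendsto_sandwich[of "\<lambda>_. 0" _ _ "\<lambda>t. A * t powr (- p - \<delta>)"])
    show "\<forall>\<^sub>F t in at_top. 1 / 2 * (xd t \<bullet> xd t) \<le> A * t powr (- p - \<delta>)"
      using eventually_ge_at_top[of T] by eventually_elim (use A R in \<open>auto intro!: less_imp_le\<close>)
    show "((\<lambda>t. A * t powr (- p - \<delta>)) \<longlongrightarrow> 0) at_top"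
      using p A(1) by (intro cmult_neg_powr_tendsto_0) simp
  qed auto
  have pot: "((\<lambda>t. eps t / 2 * (x t \<bullet> x t)) \<longlongrightarrow> 0) at_top"
    by (rule eps_times_bounded_tendsto_0[of _ R]) (use R(1) in \<open>auto simp: eventually_at_top_linorder\<close>)
  have "\<exists>l. ((\<lambda>t. f i (x t)) \<longlongrightarrow> l) at_top" for i
  proof -
    have "\<exists>l. (W i \<longlongrightarrow> l) at_top"
    proof (rule antimono_bounded_below_tendsto_at_top)
      show "W i t \<le> W i s" if "t0 \<le> s" "s \<le> t" for s t by (rule W_antimono[OF that])
      \<comment> \<open>No minimum of \<open>f i\<close> is available; the tangent plane at the
        origin gives a lower bound along the bounded trajectory.\<close>
      show "f i 0 - norm (grad i 0) * R \<le> W i t" if t: "t0 \<le> t" for t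
      proof -
        have "- (grad i 0 \<bullet> x t) \<le> norm (grad i 0) * norm (x t)"
          using Cauchy_Schwarz_ineq2[of "grad i 0" "x t"] by linarith
        also have "\<dots> \<le> norm (grad i 0) * R" using R(1)[OF t] by (simp add: mult_left_mono)
        finally have "f i 0 - norm (grad i 0) * R \<le> f i (x t)"
          using convex_on_gradient_ineq[OF conv grad, of i 0 "x t"] by simp
        also have "\<dots> \<le> W i t" unfolding W_def using eps_pos[of t] t t0 by simp
        finally show ?thesis .
      qed
    qed
    then obtain l where "(W i \<longlongrightarrow> l) at_top" by blast
    from tendsto_diff[OF tendsto_diff[OF this pot] kin] show ?thesis unfolding W_def by auto
  qed
  then show ?thesis by metis
qed

theorem tendsto_min_norm_weak_pareto:
  assumes A4: "A4 f"
  shows "\<exists>xs. (x \<longlongrightarrow> xs) at_top \<and> weak_pareto f xs \<and> (\<forall>z. (\<forall>i. f i z \<le> f i xs) \<longrightarrow> norm xs \<le> norm z)"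
proof -
  obtain R0 where R0: "\<And>t. t \<ge> t0 \<Longrightarrow> norm (x t) \<le> R0"
    using bdd unfolding bounded_pos by (metis atLeast_iff imageI)
  obtain w where w: "\<And>i. ((\<lambda>t. f i (x t)) \<longlongrightarrow> w i) at_top" using f_tendsto by blast
  have ne: "Sw f v \<noteq> {}" for v using A4 by (simp add: A4_def)
  \<comment> \<open>The moving anchor: the least-norm minimiser belonging to the current values. By
    (A4) it converges to the corresponding point \<open>z\<close> for the limit values.\<close>
  define zs where "zs t = proj0 (Sw f (\<chi> i. f i (x t)))" for t
  define z where "z = proj0 (Sw f (\<chi> i. w i))"
  have "continuous_on UNIV (\<lambda>v. proj0 (Sw f v))" using A4 by (simp add: A4_def)
  moreover have "((\<lambda>t. \<chi> i. f i (x t)) \<longlongrightarrow> (\<chi> i. w i)) at_top" by (intro tendsto_vec_lambda w)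
  ultimately have zs: "(zs \<longlongrightarrow> z) at_top"
    unfolding zs_def z_def by (rule continuous_on_tendsto_compose) auto
  define R where "R = max R0 (norm z + 1)"
  have "\<forall>\<^sub>F t in at_top. norm (zs t) < norm z + 1" by (rule order_tendstoD(2)[OF tendsto_norm[OF zs]]) simp
  then have zsR: "\<forall>\<^sub>F t in at_top. norm (zs t) \<le> R"
    by eventually_elim (simp add: R_def)
  obtain A \<delta> T where A: "\<delta> > 0" "T \<ge> t0" "\<And>t y. t \<ge> T \<Longrightarrow> norm y \<le> R \<Longrightarrow>
      (MIN i. f i (x t) - f i y) + eps t / 2 * (x t \<bullet> x t - y \<bullet> y) < A * t powr (- p - \<delta>)"
    using anchored_gap_decay[of R] by blast
  \<comment> \<open>At \<open>x t\<close> itself the maximum defining \<open>Sw\<close> is 0, so at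
    a minimiser it is at most 0.\<close>
  have zs_le: "f i (zs t) \<le> f i (x t)" for i t
  proof -
    have "zs t \<in> Sw f (\<chi> i. f i (x t))" unfolding zs_def by (rule proj0_Sw(1)[OF ne])
    then show ?thesis by (auto simp: Sw_def dest!: spec[of _ "x t"])
  qed
  have gap_nonneg: "0 \<le> (MIN i. f i (x t) - f i (zs t))" for t using zs_le by simp
  have fzs: "((\<lambda>t. f i (zs t)) \<longlongrightarrow> f i z) at_top" for i
    by (rule continuous_on_tendsto_compose[OF continuous_f[of UNIV] zs]) auto
  have fz: "f i z \<le> w i" for i
    by (rule tendsto_le[OF _ w fzs]) (auto simp: zs_le)
  \<comment> \<open>If \<open>z\<close> were strictly better in every component, the gap between
    \<open>x t\<close> and \<open>zs t\<close> would stay above a positive constant, whereas the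
    decay estimate together with the vanishing of \<open>eps\<close> forces it to be small.\<close>
  have "\<exists>i. w i \<le> f i z"
  proof (rule ccontr)
    assume "\<not> ?thesis"
    then have pos: "f i z < w i" for i by (simp add: not_le)
    define c where "c = (MIN i. w i - f i z) / 2"
    have m: "(MIN i. w i - f i z) > 0" using pos by simp
    have "c < w i - f i z" for i
    proof -
      have "(MIN i. w i - f i z) \<le> w i - f i z" by (rule Min_le) auto
      then show ?thesis using m unfolding c_def by linarith
    qed
    then have "\<forall>\<^sub>F t in at_top. c < f i (x t) - f i (zs t)" for i
      by (intro order_tendstoD(1)[OF tendsto_diff[OF w fzs]])
    then have 1: "\<forall>\<^sub>F t in at_top. \<forall>i. c < f i (x t) - f i (zs t)" by (simp add: eventually_all_finite)
    have "((\<lambda>t. A * t powr (- p - \<delta>) + eps t / 2 * (zs t \<bullet> zs t)) \<longlongrightarrow> 0 + 0) at_top"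
    proof (intro tendsto_add eps_times_bounded_tendsto_0[OF zsR])
      show "((\<lambda>t. A * t powr (- p - \<delta>)) \<longlongrightarrow> 0) at_top"
        using p A(1) by (intro cmult_neg_powr_tendsto_0) simp
    qed
    then have 2: "\<forall>\<^sub>F t in at_top. A * t powr (- p - \<delta>) + eps t / 2 * (zs t \<bullet> zs t) < c"
      using m by (intro order_tendstoD(2)) (auto simp: c_def)
    have "\<forall>\<^sub>F t::real in at_top. False"
      using 1 2 zsR eventually_ge_at_top[of T]
    proof eventually_elim
      case (elim t)
      have "c < (MIN i. f i (x t) - f i (zs t))" using elim(1) by simp
      moreover have "eps t / 2 * (x t \<bullet> x t) \<ge> 0" using elim(4) A(2) t0 eps_pos[of t] by simp
      ultimately show ?case
        using A(3)[OF elim(4,3)] elim(2) unfolding right_diff_distrib by linarith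
    qed
    then show False by simp
  qed
  then obtain i0 where "w i0 \<le> f i0 z" by blast
  then have i0: "f i0 z = w i0" using fz[of i0] by simp
  \<comment> \<open>The optimal value for \<open>w\<close> is 0, so \<open>Sw\<close> at
    \<open>w\<close> is exactly the joint sublevel set at level \<open>w\<close>.\<close>
  then have Max0: "Max (range (\<lambda>i. f i z - w i)) = 0"
    using fz by (intro Max_eqI) (auto intro: rev_image_eqI[of i0])
  have z: "z \<in> Sw f (\<chi> i. w i)" "\<And>y. y \<in> Sw f (\<chi> i. w i) \<Longrightarrow> norm z \<le> norm y"
    unfolding z_def using proj0_Sw[OF ne] by auto
  have Sw: "Sw f (\<chi> i. w i) = {y. \<forall>i. f i y \<le> w i}"
    using Sw_eq_sublevel[OF z(1)] Max0 by simp
  \<comment> \<open>The values reach \<open>w\<close> only in the limit, so the trajectory is only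
    known to enter sublevel sets with some slack; these shrink to the exact one.\<close>
  define C where "C n = {y. \<forall>i. f i y \<le> w i + 1 / real (Suc n)}" for n
  have INT_C: "(\<Inter>n. C n) = {y. \<forall>i. f i y \<le> w i}"
  proof (intro equalityI subsetI CollectI allI)
    fix y i assume y: "y \<in> (\<Inter>n. C n)"
    show "f i y \<le> w i"
    proof (rule field_le_epsilon)
      fix e :: real assume "e > 0"
      then obtain n where "1 / real (Suc n) < e" using nat_approx_posE by blast
      moreover have "f i y \<le> w i + 1 / real (Suc n)" using y unfolding C_def by blast
      ultimately show "f i y \<le> w i + e" by linarith
    qed
  qed (auto simp: C_def intro: add_increasing2)
  have lim: "(x \<longlongrightarrow> z) at_top"
  proof (rule tendsto_min_norm_decseq_convex)
    show "closed (C n)" "convex (C n)" for n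
      unfolding C_def by (rule closed_convex_sublevels[OF conv continuous_f])+
    show "decseq C"
    proof (rule decseq_SucI, rule subsetI)
      fix n y assume "y \<in> C (Suc n)"
      moreover have "1 / real (Suc (Suc n)) \<le> 1 / real (Suc n)" by (simp add: frac_le)
      ultimately show "y \<in> C n" unfolding C_def by (auto intro: order_trans[OF _ add_left_mono])
    qed
    show "z \<in> (\<Inter>n. C n)" "\<And>y. y \<in> (\<Inter>n. C n) \<Longrightarrow> norm z \<le> norm y"
      unfolding INT_C using z Sw by auto
    show "\<forall>\<^sub>F t in at_top. x t \<in> C n" for n
    proof -
      have "\<forall>\<^sub>F t in at_top. f i (x t) < w i + 1 / real (Suc n)" for i
        by (rule order_tendstoD(2)[OF w]) simp
      then have "\<forall>\<^sub>F t in at_top. \<forall>i. f i (x t) < w i + 1 / real (Suc n)" by (simp add: eventually_all_finite)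
      then show ?thesis by eventually_elim (auto simp: C_def intro: less_imp_le)
    qed
    fix e :: real assume e: "e > 0"
    \<comment> \<open>The second summand is the decay bound divided by \<open>eps t / 2\<close>;
      since the gap is nonnegative, it bounds the excess of \<open>|x t|^2\<close> over
      \<open>|zs t|^2\<close>.\<close>
    have "((\<lambda>t. (norm (zs t))\<^sup>2 + 2 * A / \<beta> * t powr (- \<delta>)) \<longlongrightarrow> (norm z)\<^sup>2) at_top"
      using tendsto_add[OF tendsto_power[OF tendsto_norm[OF zs], of 2] cmult_neg_powr_tendsto_0[of "- \<delta>" "2 * A / \<beta>"]]
        A(1) by simp
    then have "\<forall>\<^sub>F t in at_top. (norm (zs t))\<^sup>2 + 2 * A / \<beta> * t powr (- \<delta>) < (norm z)\<^sup>2 + e"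
      by (rule order_tendstoD) (use e in simp)
    then show "\<forall>\<^sub>F t in at_top. (norm (x t))\<^sup>2 < (norm z)\<^sup>2 + e"
      using zsR eventually_ge_at_top[of T]
    proof eventually_elim
      case (elim t)
      have t: "t > 0" using elim(3) A(2) t0 by simp
      have "eps t / 2 * (x t \<bullet> x t - zs t \<bullet> zs t) < A * t powr (- p - \<delta>)"
        using A(3)[OF elim(3,2)] gap_nonneg[of t] by linarith
      also have "\<dots> = eps t / 2 * (2 * A / \<beta> * t powr (- \<delta>))"
      proof -
        have "t powr (- p - \<delta>) = t powr (- p) * t powr (- \<delta>)" by (simp only: powr_add[symmetric]) simp
        then show ?thesis using \<beta> by (simp add: eps_def)
      qed
      finally have "x t \<bullet> x t - zs t \<bullet> zs t < 2 * A / \<beta> * t powr (- \<delta>)"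
        by (rule mult_left_less_imp_less) (use eps_pos[OF t] in simp)
      then show ?case using elim(1) unfolding power2_norm_eq_inner by linarith
    qed
  qed
  \<comment> \<open>Equality was known so far for one index only. Strong convergence gives it for
    all, which identifies level \<open>w\<close> with the values at the limit point.\<close>
  have fzw: "f i z = w i" for i
    using tendsto_unique[OF _ continuous_on_tendsto_compose[OF continuous_f[of UNIV] lim] w] by auto
  have "weak_pareto f z"
    unfolding weak_pareto_def
  proof
    assume "\<exists>y. \<forall>i. f i y < f i z"
    then obtain y where "\<And>i. f i y < w i" by (auto simp: fzw)
    \<comment> \<open>A point strictly better in every component would make the maximum negative,
      below its optimal value 0.\<close>
    then have "Max (range (\<lambda>i. f i y - w i)) < 0" by simp
    moreover have "Max (range (\<lambda>i. f i z - w i)) \<le> Max (range (\<lambda>i. f i y - w i))"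
      using z(1) unfolding Sw_def by simp
    ultimately show False using Max0 by linarith
  qed
  moreover have "\<forall>y. (\<forall>i. f i y \<le> f i z) \<longrightarrow> norm z \<le> norm y"
    using z(2) unfolding Sw fzw by blast
  ultimately show ?thesis using lim by blast
qed

end

section \<open>From the definition of a solution to the convergence theorem\<close>

theorem mainTheorem14:
  fixes f :: "'i::finite \<Rightarrow> 'a::{real_inner, complete_space} \<Rightarrow> real"
    and grad :: "'i \<Rightarrow> 'a \<Rightarrow> 'a"
    and t0 \<alpha> \<beta> q p :: real and x0 v0 :: 'a and x :: "real \<Rightarrow> 'a"
  assumes conv: "\<And>i. convex_on UNIV (f i)"
    and grad: "\<And>i y. (f i has_derivative (\<lambda>h. grad i y \<bullet> h)) (at y)"
    and lip: "\<And>i. \<exists>L. L-lipschitz_on UNIV (grad i)"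
    and t0: "t0 > 0" and \<alpha>: "\<alpha> > 0" and \<beta>: "\<beta> > 0"
    and q: "0 < q" "q < 1" and p: "0 < p" "p \<le> 2" "p < q + 1"
    and A3: "A3 f t0 \<beta> p x0 v0" and A4: "A4 f"
    and sol: "mtrigs_solution grad t0 \<alpha> \<beta> q p x0 v0 x"
    and bdd: "bounded (x ` {t0..})"
  shows "\<exists>xs. (x \<longlongrightarrow> xs) at_top \<and> weak_pareto f xs \<and>
           xs \<in> {z. \<forall>i. f i z \<le> f i xs} \<and>
           (\<forall>z\<in>{z. \<forall>i. f i z \<le> f i xs}. norm xs \<le> norm z)"
proof -
  obtain xd xdd N1 N2 where s: "\<And>t. t \<ge> t0 \<Longrightarrow> (x has_vector_derivative xd t) (at t within {t0..})"
    "\<And>T. T \<ge> t0 \<Longrightarrow> abs_cont_on t0 T xd"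
    "negligible N1" "\<And>t. t \<in> {t0..} - N1 \<Longrightarrow> (xd has_vector_derivative xdd t) (at t within {t0..})"
    "negligible N2" "\<And>t. t \<in> {t0..} - N2 \<Longrightarrow> (\<alpha> / t powr q) *\<^sub>R xd t
            + proj0 ((\<lambda>c. c + (\<beta> / t powr p) *\<^sub>R x t + xdd t) ` Cset grad (x t)) = 0"
    using sol unfolding mtrigs_solution_def by blast
  have cont: "continuous_on UNIV (grad i)" for i
    using lip lipschitz_on_continuous_on by blast
  \<comment> \<open>The two exceptional sets of the definition are merged into the single null set
    that the locale expects.\<close>
  interpret mtrigs_trajectory f grad t0 \<alpha> \<beta> q p x xd xdd "N1 \<union> N2"
    using conv grad cont t0 \<alpha> \<beta> q p s bdd by unfold_locales auto
  show ?thesis using tendsto_min_norm_weak_pareto[OF A4] by blast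
qed

end
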